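(* Let $0<\alpha<1$ and let $m_0:[0,+\infty)\to\mathbb R$ be bounded, uniformly continuous and non-decreasing with $m_0(0)=0$. Then there exists a unique bounded and uniformly continuous viscosity solution $m$ on $[0,+\infty)^2$ of $$\begin{cases}m_t+(m_\rho)_+^\alpha\,m=0,&t>0,\ \rho>0,\\ m(0,\rho)=m_0(\rho),\\ m(t,0)=0.\end{cases}$$ If $m_0$ is Lipschitz continuous, then so is $m$.
   Context: $s_+=\max(s,0)$. For continuous $f$ on $[0,\infty)^2$ and $X=(t,\rho)\in(0,\infty)^2$, $D^-f(X)=\{p\in\mathbb R^2:\liminf_{Y\to X}\frac{f(Y)-f(X)-p\cdot(Y-X)}{|Y-X|}\ge0\}$ and $D^+f(X)=\{p\in\mathbb R^2:\limsup_{Y\to X}\frac{f(Y)-f(X)-p\cdot(Y-X)}{|Y-X|}\le0\}$. A function $m\in\mathcal C([0,+\infty)^2)$ is a viscosity subsolution of the problem if $p_1+(p_2)_+^\alpha m(t,\rho)\le0$ for all $(t,\rho)\in(0,\infty)^2$ and all $(p_1,p_2)\in D^+m(t,\rho)$, and $m(0,\rho)\le m_0(\rho)$, $m(t,0)\le0$. It is a viscosity supersolution if $p_1+(p_2)_+^\alpha m(t,\rho)\ge0$ for all $(t,\rho)\in(0,\infty)^2$ and all $(p_1,p_2)\in D^-m(t,\rho)$, and $m(0,\rho)\ge m_0(\rho)$, $m(t,0)\ge0$. A viscosity solution is a function that is both. *)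

theory Defs
  imports "HOL-Analysis.Analysis"
begin

definition quadrant :: "(real \<times> real) set" where
  "quadrant = {0..} \<times> {0..}"

text \<open>
  A function on \<open>[0,\<infinity>)\<^sup>2\<close> is represented by a total function on the plane of which only the
  values on \<^const>\<open>quadrant\<close> matter; accordingly \<open>Y \<rightarrow> X\<close> stays in the quadrant (and \<open>Y \<noteq> X\<close>).
  The semidifferentials are only used at interior points \<open>X\<close>. The lower and upper limits are taken
  in the extended reals, since the difference quotients may be unbounded.
\<close>

definition subdifferential :: "(real \<times> real \<Rightarrow> real) \<Rightarrow> real \<times> real \<Rightarrow> (real \<times> real) set" where
  "subdifferential f X =
     {p. Liminf (at X within quadrant)
           (\<lambda>Y. ereal ((f Y - f X - p \<bullet> (Y - X)) / norm (Y - X))) \<ge> 0}"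

definition superdifferential :: "(real \<times> real \<Rightarrow> real) \<Rightarrow> real \<times> real \<Rightarrow> (real \<times> real) set" where
  "superdifferential f X =
     {p. Limsup (at X within quadrant)
           (\<lambda>Y. ereal ((f Y - f X - p \<bullet> (Y - X)) / norm (Y - X))) \<le> 0}"

text \<open>
  For \<open>\<alpha> > 0\<close> the convention \<open>0 powr \<alpha> = 0\<close> gives the intended value of \<open>(p\<^sub>2)\<^sub>+\<^sup>\<alpha>\<close> when \<open>p\<^sub>2 \<le> 0\<close>.
\<close>

definition viscosity_subsolution ::
    "real \<Rightarrow> (real \<Rightarrow> real) \<Rightarrow> (real \<times> real \<Rightarrow> real) \<Rightarrow> bool" where
  "viscosity_subsolution \<alpha> m\<^sub>0 m \<longleftrightarrow>
     continuous_on quadrant m \<and>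
     (\<forall>t>0. \<forall>\<rho>>0. \<forall>(p\<^sub>1, p\<^sub>2) \<in> superdifferential m (t, \<rho>).
        p\<^sub>1 + max p\<^sub>2 0 powr \<alpha> * m (t, \<rho>) \<le> 0) \<and>
     (\<forall>\<rho>\<ge>0. m (0, \<rho>) \<le> m\<^sub>0 \<rho>) \<and>
     (\<forall>t\<ge>0. m (t, 0) \<le> 0)"

definition viscosity_supersolution ::
    "real \<Rightarrow> (real \<Rightarrow> real) \<Rightarrow> (real \<times> real \<Rightarrow> real) \<Rightarrow> bool" where
  "viscosity_supersolution \<alpha> m\<^sub>0 m \<longleftrightarrow>
     continuous_on quadrant m \<and>
     (\<forall>t>0. \<forall>\<rho>>0. \<forall>(p\<^sub>1, p\<^sub>2) \<in> subdifferential m (t, \<rho>).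
        p\<^sub>1 + max p\<^sub>2 0 powr \<alpha> * m (t, \<rho>) \<ge> 0) \<and>
     (\<forall>\<rho>\<ge>0. m (0, \<rho>) \<ge> m\<^sub>0 \<rho>) \<and>
     (\<forall>t\<ge>0. m (t, 0) \<ge> 0)"

definition viscosity_solution ::
    "real \<Rightarrow> (real \<Rightarrow> real) \<Rightarrow> (real \<times> real \<Rightarrow> real) \<Rightarrow> bool" where
  "viscosity_solution \<alpha> m\<^sub>0 m \<longleftrightarrow>
     viscosity_subsolution \<alpha> m\<^sub>0 m \<and> viscosity_supersolution \<alpha> m\<^sub>0 m"

definition buc_viscosity_solution ::
    "real \<Rightarrow> (real \<Rightarrow> real) \<Rightarrow> (real \<times> real \<Rightarrow> real) \<Rightarrow> bool" where
  "buc_viscosity_solution \<alpha> m\<^sub>0 m \<longleftrightarrow>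
     viscosity_solution \<alpha> m\<^sub>0 m \<and> bounded (m ` quadrant) \<and> uniformly_continuous_on quadrant m"

end

theory Submission
  imports Defs
begin

text \<open>
  For positive solutions the substitution \<open>w = - m powr (- \<beta>)\<close> with \<open>\<beta> = \<alpha> / (1 - \<alpha>)\<close> turns the
  equation, up to constants, into \<open>w\<^sub>t + (w\<^sub>\<rho>)\<^sub>+\<^sup>\<alpha> = 0\<close>, whose Hamiltonian is concave on nonnegative
  slopes. The Hopf--Lax formula for \<open>w\<close>, transformed back, is
  \<open>m(t,x) = sup {(m\<^sub>0(x - d) powr (- \<beta>) + (\<alpha> t) powr (1 + \<beta>) d powr (- \<beta>)) powr (- 1/\<beta>) | 0 < d \<le> x}\<close>.
  It inherits the spatial modulus of continuity of \<open>m\<^sub>0\<close>; subadditivity of the cost gives one half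
  of the dynamic programming principle, hence the modulus in time and the supersolution property,
  while the subsolution property follows by moving back along the segment to a maximising \<open>d\<close>.

  Uniqueness is by doubling of variables. Supersolutions are nonnegative, so the Hamiltonian is
  monotone in \<open>m\<close> where it matters, and the linear penalty \<open>\<delta> (t + \<rho>)\<close>, which makes the maximum
  exist, only adds terms of the favourable sign.
\<close>

subsection \<open>The transformed inverse power and the Hopf--Lax cost\<close>

text \<open>For \<open>a > 0\<close> this is
  \<open>(a powr (- \<beta>) + s) powr (- 1 / \<beta>)\<close>. The factored form also gives the
  right value 0 at \<open>a = 0\<close>, where the convention \<open>0 powr (- \<beta>) = 0\<close>
  would spoil the other one.\<close>

definition decay :: "real \<Rightarrow> real \<Rightarrow> real \<Rightarrow> real" where
  "decay \<beta> a s = a * (1 + s * a powr \<beta>) powr (- 1 / \<beta>)"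

lemma decay_0_left [simp]: "decay \<beta> 0 s = 0"
  by (simp add: decay_def)

lemma decay_0_right [simp]: "decay \<beta> a 0 = a"
  by (simp add: decay_def)

lemma decay_nonneg: "a \<ge> 0 \<Longrightarrow> decay \<beta> a s \<ge> 0"
  by (simp add: decay_def)

lemma decay_pos_eq:
  assumes "\<beta> > 0" "a > 0" "s \<ge> 0"
  shows "decay \<beta> a s = (a powr (- \<beta>) + s) powr (- 1 / \<beta>)"
proof -
  have eq: "a powr (- \<beta>) + s = a powr (- \<beta>) * (1 + s * a powr \<beta>)"
    using assms by (simp add: distrib_left powr_minus field_simps)
  have "(a powr (- \<beta>) * (1 + s * a powr \<beta>)) powr (- 1 / \<beta>)
      = (a powr (- \<beta>)) powr (- 1 / \<beta>) * (1 + s * a powr \<beta>) powr (- 1 / \<beta>)"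
    using assms by (intro powr_mult)
  also have "(a powr (- \<beta>)) powr (- 1 / \<beta>) = a"
    using assms by (simp add: powr_powr)
  finally show ?thesis
    unfolding eq by (simp add: decay_def)
qed

lemma decay_pos: "a > 0 \<Longrightarrow> s \<ge> 0 \<Longrightarrow> decay \<beta> a s > 0"
  unfolding decay_def
  by (intro mult_pos_pos) (auto simp: add_pos_nonneg intro!: less_imp_neq[symmetric])

lemma decay_antimono:
  assumes "\<beta> > 0" "a \<ge> 0" "0 \<le> s" "s \<le> s'"
  shows "decay \<beta> a s' \<le> decay \<beta> a s"
  unfolding decay_def using assms
  by (intro mult_left_mono powr_mono2') (auto intro!: mult_right_mono add_pos_nonneg)

lemma decay_le: "\<beta> > 0 \<Longrightarrow> a \<ge> 0 \<Longrightarrow> s \<ge> 0 \<Longrightarrow> decay \<beta> a s \<le> a"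
  using decay_antimono[of \<beta> a 0 s] by simp

text \<open>The bound is uniform in \<open>a\<close>: a large cost forces a small value whatever the
  initial datum. This later excludes maximisers near displacement 0.\<close>

lemma decay_le_bound:
  assumes "\<beta> > 0" "a \<ge> 0" "s > 0"
  shows "decay \<beta> a s \<le> s powr (- 1 / \<beta>)"
proof (cases "a = 0")
  case False
  then show ?thesis
    using assms by (auto simp: decay_pos_eq intro!: powr_mono2')
qed simp

text \<open>The factor \<open>F\<close> multiplying the first argument is at most 1 and
  nonincreasing. The resulting nonexpansiveness passes the modulus of \<open>m\<^sub>0\<close> to
  the solution without loss.\<close>

lemma decay_diff_le:
  assumes "\<beta> > 0" "0 \<le> b" "b \<le> a" "s \<ge> 0"
  shows "decay \<beta> a s - decay \<beta> b s \<le> a - b"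
proof -
  define F where "F x = (1 + s * x powr \<beta>) powr (- 1 / \<beta>)" for x
  have F1: "F a \<le> 1"
    unfolding F_def using assms by (auto intro!: powr_mono2'[where x = 1, simplified])
  have "F a \<le> F b"
    unfolding F_def using assms
    by (intro powr_mono2') (auto intro!: mult_left_mono powr_mono2 add_pos_nonneg)
  then have "b * F a \<le> b * F b" using assms by (intro mult_left_mono)
  moreover have "(a - b) * F a \<le> (a - b) * 1" using F1 assms by (intro mult_left_mono) auto
  ultimately have "a * F a - b * F b \<le> a - b" by (simp add: algebra_simps)
  then show ?thesis by (simp add: decay_def F_def)
qed

lemma decay_mono:
  assumes "\<beta> > 0" "0 \<le> b" "b \<le> a" "s \<ge> 0"
  shows "decay \<beta> b s \<le> decay \<beta> a s"
proof (cases "b = 0")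
  case False
  with assms have "b > 0" "a > 0" by auto
  then show ?thesis
    using assms by (auto simp: decay_pos_eq intro!: powr_mono2' add_pos_nonneg)
qed (use assms in \<open>simp add: decay_nonneg\<close>)

text \<open>In the coordinate \<open>a powr (- \<beta>)\<close> the map is translation by
  \<open>s\<close>, hence the semigroup law.\<close>

lemma decay_decay:
  assumes "\<beta> > 0" "a \<ge> 0" "s \<ge> 0" "s' \<ge> 0"
  shows "decay \<beta> (decay \<beta> a s) s' = decay \<beta> a (s + s')"
proof (cases "a = 0")
  case False
  with assms have "a > 0" by simp
  then have "decay \<beta> a s > 0" "a powr (-\<beta>) + s > 0"
    using assms by (auto intro: decay_pos add_pos_nonneg)
  moreover have "decay \<beta> a s powr (- \<beta>) = a powr (- \<beta>) + s"
    using assms \<open>a > 0\<close> calculation by (simp add: decay_pos_eq powr_powr)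
  ultimately show ?thesis
    using assms \<open>a > 0\<close> by (simp add: decay_pos_eq[of _ _ s'] decay_pos_eq[of _ _ "s + s'"] add.assoc)
qed simp

text \<open>\<^term>\<open>decay \<beta> a\<close> is convex and solves \<open>y' = - y powr (1 + \<beta>) / \<beta>\<close>, \<open>y 0 = a\<close>.\<close>

lemma decay_ge_tangent:
  assumes "\<beta> > 0" "a \<ge> 0" "s \<ge> 0" "s' \<ge> 0"
  shows "decay \<beta> a s' \<ge> decay \<beta> a s + (s - s') * decay \<beta> a s powr (1 + \<beta>) / \<beta>"
proof (cases "a = 0")
  case False
  with assms have "a > 0" by simp
  define Z Z' where "Z = a powr (- \<beta>) + s" and "Z' = a powr (- \<beta>) + s'"
  have pos: "Z > 0" "Z' > 0"
    using assms \<open>a > 0\<close> by (auto simp: Z_def Z'_def intro: add_pos_nonneg)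
  have dec: "decay \<beta> a s = Z powr (- 1 / \<beta>)" "decay \<beta> a s' = Z' powr (- 1 / \<beta>)"
    using assms \<open>a > 0\<close> by (simp_all add: decay_pos_eq Z_def Z'_def)
  \<comment> \<open>In terms of this ratio the claim is a Bernoulli-type bound for
    \<open>q powr (- 1 / \<beta>)\<close>, which follows from \<open>ln q \<le> q - 1\<close> and
    \<open>1 + y \<le> exp y\<close>.\<close>
  define q where "q = Z' / Z"
  have q: "q > 0" using pos by (simp add: q_def)
  have "1 + (1 - q) / \<beta> \<le> 1 + - ln q / \<beta>"
    using ln_le_minus_one[OF q] assms by (intro add_left_mono divide_right_mono) auto
  also have "\<dots> \<le> exp (- ln q / \<beta>)" by (rule exp_ge_add_one_self)
  also have "\<dots> = q powr (- 1 / \<beta>)" using q by (simp add: powr_def)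
  finally have *: "1 + (1 - q) / \<beta> \<le> q powr (- 1 / \<beta>)" .
  have "Z powr (- 1 / \<beta>) * (1 + (1 - q) / \<beta>) \<le> Z powr (- 1 / \<beta>) * q powr (- 1 / \<beta>)"
    using * by (intro mult_left_mono) auto
  also have "\<dots> = Z' powr (- 1 / \<beta>)"
    using pos by (simp add: q_def powr_mult[symmetric] del: powr_mult)
  finally have main: "Z powr (- 1 / \<beta>) * (1 + (1 - q) / \<beta>) \<le> Z' powr (- 1 / \<beta>)" .
  have "(Z powr (- 1 / \<beta>)) powr (1 + \<beta>) = Z powr (- 1 / \<beta> + - 1)"
    unfolding powr_powr
    by (rule arg_cong[where f = "\<lambda>x. Z powr x"]) (use assms in \<open>simp add: field_simps\<close>)
  also have "\<dots> = Z powr (- 1 / \<beta>) / Z"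
    using pos by (subst powr_add) (simp add: powr_minus divide_inverse)
  finally have p: "(Z powr (- 1 / \<beta>)) powr (1 + \<beta>) = Z powr (- 1 / \<beta>) / Z" .
  have "s - s' = Z * (1 - q)" using pos by (simp add: q_def Z_def Z'_def field_simps)
  then have "(s - s') * (Z powr (- 1 / \<beta>)) powr (1 + \<beta>) / \<beta> = Z powr (- 1 / \<beta>) * ((1 - q) / \<beta>)"
    unfolding p using pos by simp
  with main show ?thesis unfolding dec by (simp only: distrib_left mult_1_right)
qed simp

section \<open>Homogeneity, subadditivity and duality of the cost\<close>

text \<open>For positive arguments this is t L(d/t), where L(v) is the supremum over p > 0 of
  \<open>\<beta> powr (1 - \<alpha>) * p powr \<alpha> - p * v\<close> with \<beta> = \<alpha> / (1
  - \<alpha>): the dual of the concave Hamiltonian of the transformed equation.\<close>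

definition travel_cost :: "real \<Rightarrow> real \<Rightarrow> real \<Rightarrow> real" where
  "travel_cost \<alpha> t d = (\<alpha> * t) powr (1 / (1 - \<alpha>)) * d powr (- (\<alpha> / (1 - \<alpha>)))"

lemma travel_cost_nonneg [simp]: "travel_cost \<alpha> t d \<ge> 0"
  by (simp add: travel_cost_def)

lemma travel_cost_0 [simp]: "travel_cost \<alpha> 0 d = 0"
  by (simp add: travel_cost_def)

lemma exponent_conj:
  fixes \<alpha> :: real
  assumes "0 < \<alpha>" "\<alpha> < 1"
  shows "1 / (1 - \<alpha>) = 1 + \<alpha> / (1 - \<alpha>)"
  using assms by (simp add: field_simps)

text \<open>The two exponents sum to 1. Hence the cost is linear in time along a ray of constant
  speed.\<close>

lemma travel_cost_scale:
  assumes "0 < \<alpha>" "\<alpha> < 1" "c \<ge> 0" "t \<ge> 0" "d > 0"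
  shows "travel_cost \<alpha> (c * t) (c * d) = c * travel_cost \<alpha> t d"
proof (cases "c = 0")
  case False
  have "(\<alpha> * (c * t)) powr (1 / (1 - \<alpha>)) = c powr (1 / (1 - \<alpha>)) * (\<alpha> * t) powr (1 / (1 - \<alpha>))"
    using powr_mult[of c "\<alpha> * t" "1 / (1 - \<alpha>)"] by (simp add: mult_ac)
  moreover have "c powr (1 / (1 - \<alpha>)) * c powr (- (\<alpha> / (1 - \<alpha>))) = c"
    unfolding powr_add[symmetric] exponent_conj[OF assms(1,2)] using assms False by simp
  ultimately show ?thesis
    by (simp add: travel_cost_def powr_mult mult_ac)
qed simp

text \<open>The cost is the perspective of a convex power, hence subadditive.\<close>

lemma travel_cost_add:
  assumes \<alpha>: "0 < \<alpha>" "\<alpha> < 1" and "t \<ge> 0" "h \<ge> 0" "d > 0" "e > 0"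
  shows "travel_cost \<alpha> (t + h) (d + e) \<le> travel_cost \<alpha> t d + travel_cost \<alpha> h e"
proof -
  have anti: "travel_cost \<alpha> t (d + e) \<le> travel_cost \<alpha> t d" if "d > 0" "e > 0" for t d e
    unfolding travel_cost_def using \<alpha> that by (intro mult_left_mono powr_mono2') auto
  \<comment> \<open>If one of the times is 0, its cost vanishes, and lengthening the displacement
    only lowers the other cost.\<close>
  consider "t = 0" | "h = 0" | "t > 0" "h > 0" using assms by linarith
  then show ?thesis
  proof cases
    case 3
    define P where "P = 1 / (1 - \<alpha>)"
    have P: "P \<ge> 1" using \<alpha> by (simp add: P_def)
    \<comment> \<open>The cost is \<open>d\<close> times a convex power of the slowness
      \<open>t / d\<close>. With weights \<open>d / (d + e)\<close> and \<open>e / (d + e)\<close>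
      the two slownesses average to \<open>(t + h) / (d + e)\<close>.\<close>
    define w where "w = e / (d + e)"
    have w: "0 < w" "w < 1" "1 - w = d / (d + e)" using assms by (auto simp: w_def field_simps)
    have split: "travel_cost \<alpha> t d = d * (\<alpha> * (t / d)) powr P" if "t \<ge> 0" "d > 0" for t d
      using travel_cost_scale[OF \<alpha>, of d "t / d" 1] that by (simp add: travel_cost_def P_def)
    have "((1 - w) *\<^sub>R (\<alpha> * (t / d)) + w *\<^sub>R (\<alpha> * (h / e))) powr P
        \<le> (1 - w) * (\<alpha> * (t / d)) powr P + w * (\<alpha> * (h / e)) powr P"
      using convex_onD[OF powr_convex[OF P], of w "\<alpha> * (t / d)" "\<alpha> * (h / e)"] w 3 assms by simp
    moreover have "(1 - w) *\<^sub>R (\<alpha> * (t / d)) + w *\<^sub>R (\<alpha> * (h / e)) = \<alpha> * ((t + h) / (d + e))"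
    proof -
      have "(1 - w) * (t / d) + w * (h / e) = (t + h) / (d + e)"
        using assms unfolding w(3) by (simp add: w_def add_divide_distrib)
      then show ?thesis
        by (simp add: distrib_left[symmetric] mult.left_commute[of _ \<alpha>] del: times_divide_eq_left times_divide_eq_right)
    qed
    ultimately have "(d + e) * (\<alpha> * ((t + h) / (d + e))) powr P
        \<le> (d + e) * ((1 - w) * (\<alpha> * (t / d)) powr P + w * (\<alpha> * (h / e)) powr P)"
      using assms by (intro mult_left_mono) auto
    also have "\<dots> = d * (\<alpha> * (t / d)) powr P + e * (\<alpha> * (h / e)) powr P"
      using assms unfolding w(3) by (simp add: w_def distrib_left)
    finally show ?thesis using assms by (simp add: split)
  qed (use anti[of d e] anti[of e d] assms in \<open>auto simp: add.commute\<close>)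
qed

text \<open>Weighted arithmetic-geometric mean inequality with weights \<alpha> and 1 - \<alpha>:
  \<open>A\<close> and \<open>B\<close> are the two terms on the right divided by their weights, and
  \<open>v\<close> cancels in the geometric mean because
  \<open>\<beta> * (1 - \<alpha>) = \<alpha>\<close>.\<close>

lemma travel_cost_young:
  assumes \<alpha>: "0 < \<alpha>" "\<alpha> < 1" and "p > 0" "v > 0" "\<mu> > 0"
  defines "\<beta> \<equiv> \<alpha> / (1 - \<alpha>)"
  shows "p powr \<alpha> * \<mu> \<le> p * v + travel_cost \<alpha> 1 v * \<mu> powr (1 + \<beta>) / \<beta>"
proof -
  define A where "A = p * v / \<alpha>"
  define B where "B = travel_cost \<alpha> 1 v * \<mu> powr (1 + \<beta>) / \<alpha>"
  have \<beta>: "\<beta> > 0" "(1 + \<beta>) * (1 - \<alpha>) = 1" "1 / (1 - \<alpha>) = 1 + \<beta>" "\<beta> * (1 - \<alpha>) = \<alpha>"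
    using \<alpha> by (auto simp: \<beta>_def field_simps)
  have pos: "A > 0" "B > 0" using assms by (auto simp: A_def B_def travel_cost_def)
  have "A powr \<alpha> * B powr (1 - \<alpha>) \<le> \<alpha> * A + (1 - \<alpha>) * B"
    using Youngs_inequality_0[of \<alpha> "1 - \<alpha>" A B] \<alpha> pos by simp
  also have "\<alpha> * A = p * v" using \<alpha> by (simp add: A_def)
  also have "(1 - \<alpha>) * B = travel_cost \<alpha> 1 v * \<mu> powr (1 + \<beta>) / \<beta>"
    using \<alpha> by (simp add: B_def \<beta>_def)
  also have "A powr \<alpha> * B powr (1 - \<alpha>) = p powr \<alpha> * \<mu>"
  proof -
    have "ln (A powr \<alpha> * B powr (1 - \<alpha>)) = \<alpha> * ln A + (1 - \<alpha>) * ln B"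
      using pos by (simp add: ln_mult ln_powr)
    also have "\<dots> = \<alpha> * (ln p + ln v - ln \<alpha>)
        + (1 - \<alpha>) * ((1 + \<beta>) * ln \<alpha> - \<beta> * ln v + (1 + \<beta>) * ln \<mu> - ln \<alpha>)"
      using assms(1-5) unfolding A_def B_def travel_cost_def \<beta>(3) \<beta>_def[symmetric]
      by (simp add: ln_mult ln_div ln_powr)
    also have "\<dots> = \<alpha> * ln p + \<alpha> * ln v - \<alpha> * ln \<alpha> + (1 + \<beta>) * (1 - \<alpha>) * ln \<alpha>
        - \<beta> * (1 - \<alpha>) * ln v + (1 + \<beta>) * (1 - \<alpha>) * ln \<mu> - (1 - \<alpha>) * ln \<alpha>"
      by (simp only: algebra_simps)
    also have "\<dots> = \<alpha> * ln p + ln \<mu>"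
      unfolding \<beta>(2,4) by (simp add: algebra_simps)
    also have "\<dots> = ln (p powr \<alpha> * \<mu>)" using assms by (simp add: ln_mult ln_powr)
    finally show ?thesis using pos assms by (simp add: ln_inj_iff del: ln_mult)
  qed
  finally show ?thesis .
qed

lemma travel_cost_young_eq:
  assumes \<alpha>: "0 < \<alpha>" "\<alpha> < 1" and "p > 0" "\<mu> > 0"
  defines "\<beta> \<equiv> \<alpha> / (1 - \<alpha>)"
  obtains v where "v > 0" "p powr \<alpha> * \<mu> = p * v + travel_cost \<alpha> 1 v * \<mu> powr (1 + \<beta>) / \<beta>"
proof -
  have \<beta>: "\<beta> > 0" "1 / (1 - \<alpha>) = 1 + \<beta>" "(1 - \<alpha>) * \<beta> = \<alpha>"
    using \<alpha> by (auto simp: \<beta>_def field_simps)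
  \<comment> \<open>The optimal speed is the derivative of \<open>\<mu> * p powr \<alpha>\<close> in
    \<open>p\<close>. It splits the left-hand side into shares \<alpha> and 1 - \<alpha>, the
    equality case of the mean inequality.\<close>
  define v where "v = \<alpha> * \<mu> * p powr (\<alpha> - 1)"
  have v: "v > 0" using assms by (simp add: v_def)
  have pv: "p * v = \<alpha> * \<mu> * p powr \<alpha>"
    using assms by (simp add: v_def powr_diff)
  have "v powr (- \<beta>) = \<alpha> powr (- \<beta>) * \<mu> powr (- \<beta>) * p powr \<alpha>"
  proof -
    have "(p powr (\<alpha> - 1)) powr (- \<beta>) = p powr \<alpha>"
      unfolding powr_powr by (rule arg_cong[where f = "\<lambda>x. p powr x"]) (use \<beta>(3) in \<open>simp add: algebra_simps\<close>)
    then show ?thesis by (simp add: v_def powr_mult)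
  qed
  then have "travel_cost \<alpha> 1 v * \<mu> powr (1 + \<beta>)
      = (\<alpha> powr (1 + \<beta>) * \<alpha> powr (- \<beta>)) * (\<mu> powr (1 + \<beta>) * \<mu> powr (- \<beta>)) * p powr \<alpha>"
    unfolding travel_cost_def \<beta>(2) \<beta>_def[symmetric] by (simp add: mult_ac)
  also have "\<dots> = \<alpha> * \<mu> * p powr \<alpha>"
    unfolding powr_add[symmetric] using assms by simp
  finally have "travel_cost \<alpha> 1 v * \<mu> powr (1 + \<beta>) / \<beta> = (1 - \<alpha>) * (\<mu> * p powr \<alpha>)"
    using \<alpha> by (simp add: \<beta>_def field_simps)
  then have "p powr \<alpha> * \<mu> = p * v + travel_cost \<alpha> 1 v * \<mu> powr (1 + \<beta>) / \<beta>"
    unfolding pv by (simp add: algebra_simps)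
  with v show thesis by (rule that)
qed

subsection \<open>Semidifferentials and comparison\<close>

text \<open>Multiplying by the norm, positive because the filter excludes \<open>X\<close>, removes
  quotients and extended reals.\<close>

lemma superdifferential_iff:
  "p \<in> superdifferential f X \<longleftrightarrow>
     (\<forall>e>0. \<forall>\<^sub>F Y in at X within quadrant. f Y - f X - p \<bullet> (Y - X) \<le> e * norm (Y - X))"
proof (intro iffI allI impI)
  fix e :: real assume p: "p \<in> superdifferential f X" and e: "e > 0"
  have *: "\<forall>y>0. \<forall>\<^sub>F Y in at X within quadrant. ereal ((f Y - f X - p \<bullet> (Y - X)) / norm (Y - X)) < y"
    using p by (simp only: superdifferential_def Limsup_le_iff mem_Collect_eq)
  have "\<forall>\<^sub>F Y in at X within quadrant. ereal ((f Y - f X - p \<bullet> (Y - X)) / norm (Y - X)) < ereal e"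
    using e by (intro *[rule_format]) simp
  moreover have "\<forall>\<^sub>F Y in at X within quadrant. Y \<noteq> X"
    by (simp add: eventually_at_filter)
  ultimately show "\<forall>\<^sub>F Y in at X within quadrant. f Y - f X - p \<bullet> (Y - X) \<le> e * norm (Y - X)"
    by eventually_elim (auto simp: pos_divide_less_eq)
next
  assume *: "\<forall>e>0. \<forall>\<^sub>F Y in at X within quadrant. f Y - f X - p \<bullet> (Y - X) \<le> e * norm (Y - X)"
  have "\<forall>\<^sub>F Y in at X within quadrant. ereal ((f Y - f X - p \<bullet> (Y - X)) / norm (Y - X)) < y"
    if y: "y > 0" for y
  proof -
    obtain e where e: "0 < e" "ereal e < y"
      using ereal_dense2[OF y] by auto
    have "\<forall>\<^sub>F Y in at X within quadrant. Y \<noteq> X"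
      by (simp add: eventually_at_filter)
    with *[rule_format, OF e(1)] show ?thesis
    proof eventually_elim
      case (elim Y)
      then have "ereal ((f Y - f X - p \<bullet> (Y - X)) / norm (Y - X)) \<le> ereal e"
        by (simp add: pos_divide_le_eq)
      from this e(2) show ?case by (rule le_less_trans)
    qed
  qed
  then show "p \<in> superdifferential f X"
    by (auto simp: superdifferential_def Limsup_le_iff)
qed

lemma subdifferential_iff_superdifferential:
  "p \<in> subdifferential f X \<longleftrightarrow> - p \<in> superdifferential (\<lambda>Y. - f Y) X"
proof -
  have "(\<lambda>Y. ereal ((- f Y - - f X - - p \<bullet> (Y - X)) / norm (Y - X)))
      = (\<lambda>Y. - ereal ((f Y - f X - p \<bullet> (Y - X)) / norm (Y - X)))"
    by (simp add: fun_eq_iff minus_divide_left)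
  then show ?thesis
    unfolding subdifferential_def superdifferential_def mem_Collect_eq
    by (simp only: ereal_Limsup_uminus) (simp add: ereal_uminus_le_0_iff)
qed

text \<open>A quadratic error is of smaller order than \<open>norm (Y - X)\<close>. Maxima of
  quadratically penalised functions supply exactly such errors.\<close>

lemma superdifferentialI_proximal:
  assumes "C \<ge> 0" "\<And>Y. Y \<in> quadrant \<Longrightarrow> f Y - f X - p \<bullet> (Y - X) \<le> C * (norm (Y - X))\<^sup>2"
  shows "p \<in> superdifferential f X"
  unfolding superdifferential_iff
proof (intro allI impI)
  fix e :: real assume e: "e > 0"
  \<comment> \<open>Dividing by \<open>C + 1\<close> rather than \<open>C\<close> includes the case
    \<open>C = 0\<close>.\<close>
  have "\<forall>\<^sub>F Y in at X within quadrant. dist Y X < e / (C + 1)"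
    using e assms(1) by (auto simp: eventually_at intro!: exI[of _ "e / (C + 1)"] divide_pos_pos)
  moreover have "\<forall>\<^sub>F Y in at X within quadrant. Y \<in> quadrant"
    by (simp add: eventually_at_filter)
  ultimately show "\<forall>\<^sub>F Y in at X within quadrant. f Y - f X - p \<bullet> (Y - X) \<le> e * norm (Y - X)"
  proof eventually_elim
    case (elim Y)
    have "C * norm (Y - X) \<le> (C + 1) * norm (Y - X)"
      by (intro mult_right_mono) auto
    also have "\<dots> \<le> e"
      using elim(1) assms(1) by (simp add: dist_norm pos_less_divide_eq mult.commute)
    finally have "C * norm (Y - X) * norm (Y - X) \<le> e * norm (Y - X)"
      by (intro mult_right_mono) auto
    with assms(2)[OF elim(2)] show ?case by (simp add: power2_eq_square)
  qed
qed

lemma subdifferentialI_proximal: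
  assumes "C \<ge> 0" "\<And>Y. Y \<in> quadrant \<Longrightarrow> f Y - f X - p \<bullet> (Y - X) \<ge> - C * (norm (Y - X))\<^sup>2"
  shows "p \<in> subdifferential f X"
  unfolding subdifferential_iff_superdifferential
  using assms(1)
proof (rule superdifferentialI_proximal)
  fix Y assume "Y \<in> quadrant"
  from assms(2)[OF this] show "- f Y - - f X - - p \<bullet> (Y - X) \<le> C * (norm (Y - X))\<^sup>2"
    by simp
qed

lemma at_within_quadrant:
  assumes "t > 0" "x > 0"
  shows "at (t, x) within quadrant = at (t, x)"
proof (rule at_within_open_subset)
  show "(t, x) \<in> {0<..} \<times> {0<..}" "{0<..} \<times> {0<..} \<subseteq> quadrant"
    using assms by (auto simp: quadrant_def)
qed (intro open_Times open_greaterThan)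

text \<open>Restricting to a ray and dividing by \<open>h\<close> leaves the directional slope. The
  quotient \<open>g h\<close> may vary with \<open>h\<close>, since dynamic programming yields
  slopes that depend on the moving point.\<close>

lemma superdifferential_ray:
  fixes a b :: real
  assumes "t > 0" "x > 0" and p: "(p\<^sub>1, p\<^sub>2) \<in> superdifferential f (t, x)"
    and le: "\<forall>\<^sub>F h in at_right 0. h * g h \<le> f (t + h * a, x + h * b) - f (t, x)"
    and g: "(g \<longlongrightarrow> c) (at_right 0)"
  shows "c \<le> p\<^sub>1 * a + p\<^sub>2 * b"
proof (rule ccontr)
  assume less: "\<not> ?thesis"
  \<comment> \<open>The first-order error \<open>e * norm (a, b)\<close> stays below the assumed
    gap; adding 1 covers the zero direction.\<close>
  define e where "e = (c - (p\<^sub>1 * a + p\<^sub>2 * b)) / (2 * (norm (a, b) + 1))"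
  have e: "e > 0" "e * norm (a, b) < c - (p\<^sub>1 * a + p\<^sub>2 * b)"
  proof -
    have n: "norm (a, b) + 1 > 0" by (simp add: add_nonneg_pos)
    then show "e > 0" using less unfolding e_def by (intro divide_pos_pos) auto
    then have "e * norm (a, b) < e * (2 * (norm (a, b) + 1))"
      by (intro mult_strict_left_mono) (auto simp: add_nonneg_pos intro: le_less_trans[of _ "2 * norm (a, b)"])
    also have "\<dots> = c - (p\<^sub>1 * a + p\<^sub>2 * b)" using n by (simp add: e_def)
    finally show "e * norm (a, b) < c - (p\<^sub>1 * a + p\<^sub>2 * b)" .
  qed
  have "\<forall>\<^sub>F Y in nhds (t, x). f Y - f (t, x) - (p\<^sub>1, p\<^sub>2) \<bullet> (Y - (t, x)) \<le> e * norm (Y - (t, x))"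
    using p[unfolded superdifferential_iff, rule_format, OF e(1)]
    by (simp add: at_within_quadrant[OF assms(1,2)] eventually_at_filter eventually_mono)
       (erule eventually_mono, auto)
  moreover have "filterlim (\<lambda>h. (t + h * a, x + h * b)) (nhds (t, x)) (at_right 0)"
    by (intro tendsto_eq_intros) auto
  ultimately have "\<forall>\<^sub>F h in at_right 0. f (t + h * a, x + h * b) - f (t, x)
      - (p\<^sub>1, p\<^sub>2) \<bullet> ((t + h * a, x + h * b) - (t, x)) \<le> e * norm ((t + h * a, x + h * b) - (t, x))"
    by (rule eventually_compose_filterlim)
  moreover have "\<forall>\<^sub>F h in at_right 0. g h > p\<^sub>1 * a + p\<^sub>2 * b + e * norm (a, b)"
    using e(2) by (intro order_tendstoD(1)[OF g]) simp
  moreover have "\<forall>\<^sub>F h in at_right (0::real). h > 0"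
    by (simp add: eventually_at_right_less)
  ultimately have "\<forall>\<^sub>F h in at_right (0::real). False"
    using le
  proof eventually_elim
    case (elim h)
    have "(t + h * a, x + h * b) - (t, x) = h *\<^sub>R (a, b)" by simp
    then have "norm ((t + h * a, x + h * b) - (t, x)) = h * norm (a, b)"
      using elim(3) by (simp only: norm_scaleR abs_of_pos)
    with elim(1,4) have "h * g h \<le> h * (p\<^sub>1 * a + p\<^sub>2 * b) + e * (h * norm (a, b))"
      by (simp add: algebra_simps)
    also have "\<dots> = h * (p\<^sub>1 * a + p\<^sub>2 * b + e * norm (a, b))" by (simp add: algebra_simps)
    finally show ?case using elim(2,3) by simp
  qed
  then show False by simp
qed

lemma subdifferential_ray:
  fixes a b :: real
  assumes "t > 0" "x > 0" and p: "(p\<^sub>1, p\<^sub>2) \<in> subdifferential f (t, x)"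
    and le: "\<forall>\<^sub>F h in at_right 0. f (t + h * a, x + h * b) - f (t, x) \<le> h * g h"
    and g: "(g \<longlongrightarrow> c) (at_right 0)"
  shows "p\<^sub>1 * a + p\<^sub>2 * b \<le> c"
proof -
  have "- c \<le> - p\<^sub>1 * a + - p\<^sub>2 * b"
  proof (rule superdifferential_ray[OF assms(1,2)])
    show "(- p\<^sub>1, - p\<^sub>2) \<in> superdifferential (\<lambda>Y. - f Y) (t, x)"
      using p by (simp add: subdifferential_iff_superdifferential)
    show "\<forall>\<^sub>F h in at_right 0. h * - g h \<le> - f (t + h * a, x + h * b) - - f (t, x)"
      using le by eventually_elim simp
  qed (intro tendsto_minus g)
  then show ?thesis by simp
qed

section \<open>Penalised maxima and the comparison principle\<close>

lemma closed_quadrant: "closed quadrant"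
  unfolding quadrant_def by (intro closed_Times closed_atLeast)

text \<open>Only the superlevel set through one point needs to be bounded: it is then compact, and a
  maximum over it is global.\<close>

lemma continuous_attains_sup_coercive:
  fixes f :: "'a :: heine_borel \<Rightarrow> real"
  assumes "closed S" "continuous_on S f" "x \<in> S" "bounded {y \<in> S. f x \<le> f y}"
  obtains z where "z \<in> S" "\<And>y. y \<in> S \<Longrightarrow> f y \<le> f z"
proof -
  let ?K = "{y \<in> S. f x \<le> f y}"
  have "?K = S \<inter> f -` {f x..}" by auto
  then have "closed ?K" using continuous_closed_preimage[OF assms(2,1), of "{f x..}"] by simp
  with assms(4) have "compact ?K" by (simp add: compact_eq_bounded_closed)
  moreover have "?K \<noteq> {}" "continuous_on ?K f"
    using assms(2,3) by (auto intro: continuous_on_subset)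
  ultimately obtain z where z: "z \<in> ?K" "\<forall>y\<in>?K. f y \<le> f z"
    by (metis (lifting) continuous_attains_sup)
  show thesis
  proof (rule that)
    fix y assume "y \<in> S"
    then show "f y \<le> f z" using z by (cases "f x \<le> f y") auto
  qed (use z in auto)
qed

lemma quadrant_norm_le: "X \<in> quadrant \<Longrightarrow> norm X \<le> fst X + snd X"
  using norm_Pair_le[of "fst X" "snd X"] by (auto simp: quadrant_def)

text \<open>Supplies the gradient of the doubling penalty together with an exact quadratic
  remainder.\<close>

lemma norm_diff_sq_expand:
  fixes W X Y :: "'a :: real_inner"
  shows "(norm (W - Y))\<^sup>2 = (norm (X - Y))\<^sup>2 + 2 * ((X - Y) \<bullet> (W - X)) + (norm (W - X))\<^sup>2"
proof -
  have "W - Y = (X - Y) + (W - X)" by simp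
  then show ?thesis
    unfolding power2_norm_eq_inner
    by (simp only: inner_add_left inner_add_right inner_commute[of "W - X" "X - Y"])
qed

text \<open>Minimise \<open>v\<close> plus \<delta>(t + \<rho>). A negative minimum is interior,
  with subgradient (-\<delta>, -\<delta>); the positive part of the second slope is 0, so the
  equation would give -\<delta> \<ge> 0.\<close>

lemma supersolution_nonneg:
  assumes super: "viscosity_supersolution \<alpha> m\<^sub>0 v" and "bounded (v ` quadrant)"
    and m0: "\<And>x. x \<ge> 0 \<Longrightarrow> m\<^sub>0 x \<ge> 0" and X\<^sub>1: "X\<^sub>1 \<in> quadrant"
  shows "v X\<^sub>1 \<ge> 0"
proof (rule ccontr)
  assume neg: "\<not> v X\<^sub>1 \<ge> 0"
  obtain C where C: "\<And>X. X \<in> quadrant \<Longrightarrow> \<bar>v X\<bar> \<le> C"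
    using assms(2) by (auto simp: bounded_iff)
  \<comment> \<open>The penalty at \<open>X\<^sub>1\<close> uses at most half of the deficit, so the
    penalised value there stays negative.\<close>
  define \<delta> where "\<delta> = - v X\<^sub>1 / (2 * (1 + fst X\<^sub>1 + snd X\<^sub>1))"
  have s1: "fst X\<^sub>1 + snd X\<^sub>1 \<ge> 0" using X\<^sub>1 by (auto simp: quadrant_def)
  then have \<delta>: "\<delta> > 0" unfolding \<delta>_def using neg by (intro divide_pos_pos) auto
  have "\<delta> * (2 * (1 + fst X\<^sub>1 + snd X\<^sub>1)) = - v X\<^sub>1" using s1 by (simp add: \<delta>_def)
  moreover have "\<delta> * (fst X\<^sub>1 + snd X\<^sub>1) \<le> \<delta> * (2 * (1 + fst X\<^sub>1 + snd X\<^sub>1)) / 2"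
    using \<delta> by simp
  ultimately have \<delta>1: "v X\<^sub>1 + \<delta> * (fst X\<^sub>1 + snd X\<^sub>1) < 0" using neg by simp
  define F where "F X = - (v X + \<delta> * (fst X + snd X))" for X
  have bnd: "bounded {X \<in> quadrant. F X\<^sub>1 \<le> F X}"
  proof (rule boundedI)
    fix X assume X: "X \<in> {X \<in> quadrant. F X\<^sub>1 \<le> F X}"
    then have "\<delta> * (fst X + snd X) \<le> C"
      using C[of X] \<delta>1 by (auto simp: F_def)
    then have "fst X + snd X \<le> C / \<delta>" using \<delta> by (simp add: field_simps)
    with X quadrant_norm_le[of X] show "norm X \<le> C / \<delta>" by auto
  qed
  have cont: "continuous_on quadrant F"
    using super unfolding F_def viscosity_supersolution_def by (intro continuous_intros) auto
  obtain X where X: "X \<in> quadrant" "\<And>Y. Y \<in> quadrant \<Longrightarrow> F Y \<le> F X"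
    using continuous_attains_sup_coercive[OF closed_quadrant cont X\<^sub>1 bnd] by blast
  obtain t x where tx: "X = (t, x)" by (cases X)
  have nn: "t \<ge> 0" "x \<ge> 0" using X(1) by (auto simp: tx quadrant_def)
  have vX: "v X < 0" using X(2)[OF X\<^sub>1] \<delta>1 \<delta> nn by (simp add: F_def tx) (smt (verit) mult_nonneg_nonneg)
  have "v (0, x) \<ge> 0" "v (t, 0) \<ge> 0"
    using super m0[of x] nn unfolding viscosity_supersolution_def by (auto intro: order_trans)
  with vX nn have pos: "t > 0" "x > 0" unfolding tx by (auto simp: less_le)
  have "(- \<delta>, - \<delta>) \<in> subdifferential v X"
  proof (rule subdifferentialI_proximal[of 0])
    fix Y assume "Y \<in> quadrant"
    from X(2)[OF this] show "v Y - v X - (- \<delta>, - \<delta>) \<bullet> (Y - X) \<ge> - 0 * (norm (Y - X))\<^sup>2"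
      by (simp add: F_def inner_prod_def algebra_simps)
  qed simp
  then have "- \<delta> + max (- \<delta>) 0 powr \<alpha> * v X \<ge> 0"
    using super pos unfolding viscosity_supersolution_def tx by fast
  with \<delta> show False by simp
qed

text \<open>Uniform continuity permits one fixed penalty constant \<open>K\<close>, so no limit is
  taken; the linear penalty alone leaves a strict contradiction.\<close>

lemma comparison:
  assumes sub: "viscosity_subsolution \<alpha> m\<^sub>0 u" and super: "viscosity_supersolution \<alpha> m\<^sub>0 v"
    and "bounded (u ` quadrant)" "bounded (v ` quadrant)"
    and "uniformly_continuous_on quadrant u" "uniformly_continuous_on quadrant v"
    and m0: "\<And>x. x \<ge> 0 \<Longrightarrow> m\<^sub>0 x \<ge> 0" and \<alpha>: "\<alpha> \<ge> 0" and X\<^sub>1: "X\<^sub>1 \<in> quadrant"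
  shows "u X\<^sub>1 \<le> v X\<^sub>1"
proof (rule ccontr)
  assume neg: "\<not> u X\<^sub>1 \<le> v X\<^sub>1"
  obtain C\<^sub>1 C\<^sub>2 where "\<And>X. X \<in> quadrant \<Longrightarrow> \<bar>u X\<bar> \<le> C\<^sub>1" "\<And>X. X \<in> quadrant \<Longrightarrow> \<bar>v X\<bar> \<le> C\<^sub>2"
    using assms(3,4) by (auto simp: bounded_iff)
  then obtain C where C: "\<And>X Y. X \<in> quadrant \<Longrightarrow> Y \<in> quadrant \<Longrightarrow> u X - v Y \<le> C"
    using that[of "C\<^sub>1 + C\<^sub>2"] by (smt (verit))
  define \<delta> where "\<delta> = (u X\<^sub>1 - v X\<^sub>1) / (2 * (1 + fst X\<^sub>1 + snd X\<^sub>1))"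
  \<comment> \<open>This is the doubled functional at \<open>(X\<^sub>1, X\<^sub>1)\<close>, hence a
    positive lower bound for its maximum.\<close>
  define \<sigma> where "\<sigma> = u X\<^sub>1 - v X\<^sub>1 - \<delta> * (fst X\<^sub>1 + snd X\<^sub>1)"
  have s1: "fst X\<^sub>1 + snd X\<^sub>1 \<ge> 0" using X\<^sub>1 by (auto simp: quadrant_def)
  then have \<delta>: "\<delta> > 0" unfolding \<delta>_def using neg by (intro divide_pos_pos) auto
  have "\<delta> * (2 * (1 + fst X\<^sub>1 + snd X\<^sub>1)) = u X\<^sub>1 - v X\<^sub>1" using s1 by (simp add: \<delta>_def)
  moreover have "\<delta> * (fst X\<^sub>1 + snd X\<^sub>1) \<le> \<delta> * (2 * (1 + fst X\<^sub>1 + snd X\<^sub>1)) / 2"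
    using \<delta> by simp
  ultimately have \<sigma>: "\<sigma> > 0" using neg by (simp add: \<sigma>_def)
  obtain \<eta>\<^sub>1 \<eta>\<^sub>2 where "\<eta>\<^sub>1 > 0" "\<eta>\<^sub>2 > 0"
    and \<eta>\<^sub>1: "\<And>X Y. X \<in> quadrant \<Longrightarrow> Y \<in> quadrant \<Longrightarrow> dist X Y < \<eta>\<^sub>1 \<Longrightarrow> dist (u X) (u Y) < \<sigma>"
    and \<eta>\<^sub>2: "\<And>X Y. X \<in> quadrant \<Longrightarrow> Y \<in> quadrant \<Longrightarrow> dist X Y < \<eta>\<^sub>2 \<Longrightarrow> dist (v X) (v Y) < \<sigma>"
    using assms(5,6) \<sigma> unfolding uniformly_continuous_on_def by (metis dist_commute)
  define \<eta> where "\<eta> = min \<eta>\<^sub>1 \<eta>\<^sub>2"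
  have \<eta>: "\<eta> > 0" using \<open>\<eta>\<^sub>1 > 0\<close> \<open>\<eta>\<^sub>2 > 0\<close> by (simp add: \<eta>_def)
  \<comment> \<open>As \<open>K * \<eta>\<^sup>2 > C\<close>, the two points of a maximiser are
    closer than \<eta>, and \<open>u\<close> and \<open>v\<close> change by less than \<sigma>
    between them.\<close>
  define K where "K = (\<bar>C\<bar> + 1) / \<eta>\<^sup>2"
  have K: "K > 0" "K * \<eta>\<^sup>2 > C" using \<eta> by (simp_all add: K_def add_nonneg_pos)
  define F where "F Z = u (fst Z) - v (snd Z) - K * (norm (fst Z - snd Z))\<^sup>2
      - \<delta> * (fst (fst Z) + snd (fst Z))" for Z :: "(real \<times> real) \<times> (real \<times> real)"
  have large: "\<delta> * (fst X + snd X) \<le> C \<and> norm (X - Y) < \<eta> \<and> u X - v Y \<ge> \<sigma>"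
    if XY: "X \<in> quadrant" "Y \<in> quadrant" and "F (X\<^sub>1, X\<^sub>1) \<le> F (X, Y)" for X Y
  proof -
    have "\<sigma> \<le> u X - v Y - K * (norm (X - Y))\<^sup>2 - \<delta> * (fst X + snd X)"
      using that(3) by (simp add: F_def \<sigma>_def)
    moreover have "K * (norm (X - Y))\<^sup>2 \<ge> 0" "\<delta> * (fst X + snd X) \<ge> 0"
      using K \<delta> XY by (auto simp: quadrant_def)
    ultimately have *: "K * (norm (X - Y))\<^sup>2 \<le> C" "\<delta> * (fst X + snd X) \<le> C" "u X - v Y \<ge> \<sigma>"
      using C[OF XY] \<sigma> by linarith+
    have "(norm (X - Y))\<^sup>2 < \<eta>\<^sup>2"
      using *(1) K by (smt (verit) mult_left_mono)
    then have "norm (X - Y) < \<eta>" using \<eta> by (simp add: power_less_imp_less_base)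
    with * show ?thesis by simp
  qed
  have bnd: "bounded {Z \<in> quadrant \<times> quadrant. F (X\<^sub>1, X\<^sub>1) \<le> F Z}"
  proof (rule boundedI)
    fix Z assume Z: "Z \<in> {Z \<in> quadrant \<times> quadrant. F (X\<^sub>1, X\<^sub>1) \<le> F Z}"
    obtain X Y where XY: "Z = (X, Y)" by (cases Z)
    have l: "\<delta> * (fst X + snd X) \<le> C" "norm (X - Y) < \<eta>" using large[of X Y] Z XY by auto
    have "\<delta> * norm X \<le> \<delta> * (fst X + snd X)"
      using Z XY \<delta> by (intro mult_left_mono quadrant_norm_le) auto
    from order_trans[OF this l(1)] have "norm X \<le> C / \<delta>"
      using \<delta> by (simp add: pos_le_divide_eq mult.commute)
    moreover have "norm Y \<le> norm X + norm (X - Y)"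
      using norm_triangle_ineq4[of X "X - Y"] by simp
    ultimately show "norm Z \<le> C / \<delta> + (C / \<delta> + \<eta>)"
      using norm_Pair_le[of X Y] l XY by simp
  qed
  have cont: "continuous_on (quadrant \<times> quadrant) F"
  proof -
    have "continuous_on quadrant u" "continuous_on quadrant v"
      using sub super by (auto simp: viscosity_subsolution_def viscosity_supersolution_def)
    then have "continuous_on (quadrant \<times> quadrant) (\<lambda>Z. u (fst Z))"
        "continuous_on (quadrant \<times> quadrant) (\<lambda>Z. v (snd Z))"
      by (auto intro!: continuous_on_compose2[of quadrant _ _ fst] continuous_on_compose2[of quadrant _ _ snd]
          continuous_intros)
    then show ?thesis unfolding F_def by (intro continuous_intros)
  qed
  obtain Z where Z: "Z \<in> quadrant \<times> quadrant"
      "\<And>Y. Y \<in> quadrant \<times> quadrant \<Longrightarrow> F Y \<le> F Z"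
    using continuous_attains_sup_coercive[OF closed_Times[OF closed_quadrant closed_quadrant] cont _ bnd]
      X\<^sub>1 by blast
  obtain X Y where XY: "Z = (X, Y)" by (cases Z)
  have q: "X \<in> quadrant" "Y \<in> quadrant" using Z(1) XY by auto
  have max: "F (X', Y') \<le> F (X, Y)" if "X' \<in> quadrant" "Y' \<in> quadrant" for X' Y'
    using Z(2)[of "(X', Y')"] that XY by simp
  have near: "norm (X - Y) < \<eta>" and gap: "u X - v Y \<ge> \<sigma>"
    using large[OF q max[OF X\<^sub>1 X\<^sub>1]] by auto
  have bdry: "u W \<le> v W" if W: "W \<in> quadrant" "fst W = 0 \<or> snd W = 0" for W
  proof (cases W)
    case (Pair t x)
    show ?thesis
    proof (cases "t = 0")
      case True
      then have "u W \<le> m\<^sub>0 x" "m\<^sub>0 x \<le> v W"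
        using sub super W unfolding Pair viscosity_subsolution_def viscosity_supersolution_def quadrant_def
        by auto
      then show ?thesis by simp
    next
      case False
      then have "u W \<le> 0" "0 \<le> v W"
        using sub super W unfolding Pair viscosity_subsolution_def viscosity_supersolution_def quadrant_def
        by auto
      then show ?thesis by simp
    qed
  qed
  \<comment> \<open>If \<open>X\<close> were on the boundary, then
    \<open>u X \<le> v X < v Y + \<sigma>\<close>; if \<open>Y\<close> were, then
    \<open>u X < u Y + \<sigma> \<le> v Y + \<sigma>\<close>. Both contradict the gap.\<close>
  have "dist X Y < \<eta>\<^sub>1" "dist X Y < \<eta>\<^sub>2" using near by (simp_all add: dist_norm \<eta>_def)
  with \<eta>\<^sub>1[OF q] \<eta>\<^sub>2[OF q] have "u X < u Y + \<sigma>" "v X < v Y + \<sigma>"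
    by (auto simp: dist_real_def)
  with gap bdry[OF q(1)] bdry[OF q(2)]
  have interior: "fst X \<noteq> 0 \<and> snd X \<noteq> 0 \<and> fst Y \<noteq> 0 \<and> snd Y \<noteq> 0" by force
  obtain t x where X: "X = (t, x)" by (cases X)
  obtain s y where Y: "Y = (s, y)" by (cases Y)
  have pos: "t > 0" "x > 0" "s > 0" "y > 0"
    using interior q by (auto simp: X Y quadrant_def)
  define p\<^sub>1 p\<^sub>2 where "p\<^sub>1 = 2 * K * (t - s)" and "p\<^sub>2 = 2 * K * (x - y)"
  have p: "(p\<^sub>1, p\<^sub>2) = (2 * K) *\<^sub>R (X - Y)"
    by (simp add: p\<^sub>1_def p\<^sub>2_def X Y)
  \<comment> \<open>The linear penalty involves \<open>X\<close> only, so it shifts the gradient of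
    \<open>u\<close> and not that of \<open>v\<close>.\<close>
  have "(p\<^sub>1 + \<delta>, p\<^sub>2 + \<delta>) \<in> superdifferential u X"
  proof (rule superdifferentialI_proximal[of K])
    fix W assume "W \<in> quadrant"
    from max[OF this q(2)]
    have "u W - u X \<le> K * (norm (W - Y))\<^sup>2 - K * (norm (X - Y))\<^sup>2
        + (\<delta> * (fst W + snd W) - \<delta> * (fst X + snd X))"
      by (simp add: F_def)
    also have "K * (norm (W - Y))\<^sup>2 - K * (norm (X - Y))\<^sup>2 = (p\<^sub>1, p\<^sub>2) \<bullet> (W - X) + K * (norm (W - X))\<^sup>2"
      unfolding p norm_diff_sq_expand[of W Y X] by (simp add: distrib_left)
    also have "\<delta> * (fst W + snd W) - \<delta> * (fst X + snd X) = (\<delta>, \<delta>) \<bullet> (W - X)"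
      by (simp add: inner_prod_def algebra_simps)
    finally show "u W - u X - (p\<^sub>1 + \<delta>, p\<^sub>2 + \<delta>) \<bullet> (W - X) \<le> K * (norm (W - X))\<^sup>2"
      using inner_add_left[of "(p\<^sub>1, p\<^sub>2)" "(\<delta>, \<delta>)" "W - X"] by simp
  qed (use K in simp)
  then have 1: "(p\<^sub>1 + \<delta>) + max (p\<^sub>2 + \<delta>) 0 powr \<alpha> * u X \<le> 0"
    using sub pos unfolding viscosity_subsolution_def X by fast
  have "(p\<^sub>1, p\<^sub>2) \<in> subdifferential v Y"
  proof (rule subdifferentialI_proximal[of K])
    fix W assume "W \<in> quadrant"
    from max[OF q(1) this]
    have "v W - v Y \<ge> K * (norm (Y - X))\<^sup>2 - K * (norm (W - X))\<^sup>2"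
      by (simp add: F_def norm_minus_commute)
    also have "K * (norm (Y - X))\<^sup>2 - K * (norm (W - X))\<^sup>2 = (p\<^sub>1, p\<^sub>2) \<bullet> (W - Y) - K * (norm (W - Y))\<^sup>2"
      unfolding p norm_diff_sq_expand[of W X Y] by (simp add: algebra_simps)
    finally show "v W - v Y - (p\<^sub>1, p\<^sub>2) \<bullet> (W - Y) \<ge> - K * (norm (W - Y))\<^sup>2"
      by simp
  qed (use K in simp)
  then have 2: "p\<^sub>1 + max p\<^sub>2 0 powr \<alpha> * v Y \<ge> 0"
    using super pos unfolding viscosity_supersolution_def Y by fast
  have "v Y \<ge> 0" by (rule supersolution_nonneg[OF super assms(4) m0 q(2)])
  \<comment> \<open>Slope and value are both larger for \<open>u\<close>, and
    \<open>v Y \<ge> 0\<close>, so the Hamiltonian is larger too. The two viscosity inequalities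
    then leave \<delta> \<le> 0.\<close>
  then have "max p\<^sub>2 0 powr \<alpha> * v Y \<le> max (p\<^sub>2 + \<delta>) 0 powr \<alpha> * u X"
    using gap \<sigma> \<delta> \<alpha> by (intro mult_mono powr_mono2) auto
  with 1 2 \<delta> show False by simp
qed

subsection \<open>The Hopf--Lax solution\<close>

text \<open>The upper bound \<open>M\<close> is carried explicitly because it enters the modulus in
  time.\<close>

locale hopf_lax =
  fixes \<alpha> :: real and m\<^sub>0 :: "real \<Rightarrow> real" and M :: real
  assumes \<alpha>: "0 < \<alpha>" "\<alpha> < 1"
    and m0_cont: "uniformly_continuous_on {0..} m\<^sub>0"
    and m0_mono: "mono_on {0..} m\<^sub>0"
    and m0_0 [simp]: "m\<^sub>0 0 = 0"
    and m0_le_M: "\<And>x. x \<ge> 0 \<Longrightarrow> m\<^sub>0 x \<le> M"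
begin

definition \<beta> :: real where "\<beta> = \<alpha> / (1 - \<alpha>)"

definition candidate :: "real \<Rightarrow> real \<Rightarrow> real \<Rightarrow> real" where
  "candidate t x d = decay \<beta> (m\<^sub>0 (x - d)) (travel_cost \<alpha> t d)"

text \<open>
  The endpoint \<open>d = 0\<close> is left out because \<open>0 powr (- \<beta>) = 0\<close> would make displacement \<open>0\<close> free.
\<close>

definition hl :: "real \<Rightarrow> real \<Rightarrow> real" where
  "hl t x = (if x \<le> 0 then 0 else SUP d\<in>{0<..x}. candidate t x d)"

lemma \<beta>_pos: "\<beta> > 0"
  using \<alpha> by (simp add: \<beta>_def)

lemma m0_le: "0 \<le> x \<Longrightarrow> x \<le> y \<Longrightarrow> m\<^sub>0 x \<le> m\<^sub>0 y"
  using m0_mono by (auto simp: mono_on_def)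

lemma m0_nonneg: "x \<ge> 0 \<Longrightarrow> m\<^sub>0 x \<ge> 0"
  using m0_le[of 0 x] by simp

lemma candidate_nonneg: "d \<le> x \<Longrightarrow> candidate t x d \<ge> 0"
  by (simp add: candidate_def decay_nonneg m0_nonneg)

lemma candidate_le_m0: "d \<le> x \<Longrightarrow> candidate t x d \<le> m\<^sub>0 (x - d)"
  unfolding candidate_def using \<beta>_pos by (intro decay_le) (auto simp: m0_nonneg)

lemma hl_upper:
  assumes "0 < d" "d \<le> x"
  shows "candidate t x d \<le> hl t x"
proof -
  have "bdd_above (candidate t x ` {0<..x})"
  proof (rule bdd_aboveI2)
    fix d assume "d \<in> {0<..x}"
    then show "candidate t x d \<le> M"
      using candidate_le_m0[of d x t] m0_le_M[of "x - d"] by simp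
  qed
  then have "candidate t x d \<le> (SUP d\<in>{0<..x}. candidate t x d)"
    using assms by (intro cSUP_upper) auto
  then show ?thesis using assms by (simp add: hl_def)
qed

lemma hl_least:
  assumes "\<And>d. 0 < d \<Longrightarrow> d \<le> x \<Longrightarrow> candidate t x d \<le> c" "c \<ge> 0"
  shows "hl t x \<le> c"
proof (cases "x \<le> 0")
  case False
  then have "(SUP d\<in>{0<..x}. candidate t x d) \<le> c"
    using assms(1) by (intro cSUP_least) auto
  with False show ?thesis by (simp add: hl_def)
qed (use assms(2) in \<open>simp add: hl_def\<close>)

lemma hl_at_0 [simp]: "hl t 0 = 0"
  by (simp add: hl_def)

lemma hl_nonneg: "hl t x \<ge> 0"
proof (cases "x \<le> 0")
  case False
  then show ?thesis
    using candidate_nonneg[of x x t] hl_upper[of x x t] by simp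
qed (simp add: hl_def)

lemma hl_le_m0:
  assumes "x \<ge> 0"
  shows "hl t x \<le> m\<^sub>0 x"
proof (rule hl_least)
  fix d assume "0 < d" "d \<le> x"
  then show "candidate t x d \<le> m\<^sub>0 x"
    using candidate_le_m0[of d x t] m0_le[of "x - d" x] by simp
qed (use assms in \<open>rule m0_nonneg\<close>)

lemma hl_le_M: "x \<ge> 0 \<Longrightarrow> hl t x \<le> M"
  using hl_le_m0 m0_le_M by (rule order_trans)

text \<open>At time 0 the cost vanishes and the candidates are \<open>m\<^sub>0 (x - d)\<close>.
  Since \<open>d = 0\<close> is excluded, the value \<open>m\<^sub>0 x\<close> is reached through
  continuity.\<close>

lemma hl_initial:
  assumes "x \<ge> 0"
  shows "hl 0 x = m\<^sub>0 x"
proof (cases "x = 0")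
  case False
  with assms have x: "x > 0" by simp
  have "m\<^sub>0 x \<le> hl 0 x"
  proof (rule field_le_epsilon)
    fix e :: real assume "e > 0"
    then obtain \<delta> where \<delta>: "\<delta> > 0" "\<And>y. y \<ge> 0 \<Longrightarrow> dist y x < \<delta> \<Longrightarrow> dist (m\<^sub>0 y) (m\<^sub>0 x) < e"
      using m0_cont x unfolding uniformly_continuous_on_def by (metis atLeast_iff less_imp_le)
    define d where "d = min x (\<delta> / 2)"
    have d: "0 < d" "d \<le> x" "d < \<delta>" using x \<delta>(1) by (auto simp: d_def)
    have "m\<^sub>0 x \<le> m\<^sub>0 (x - d) + e"
      using \<delta>(2)[of "x - d"] d by (auto simp: dist_real_def)
    then show "m\<^sub>0 x \<le> hl 0 x + e"
      using hl_upper[OF d(1,2), of 0] by (simp add: candidate_def)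
  qed
  with hl_le_m0[OF assms] show ?thesis by (simp add: order_antisym)
qed simp

section \<open>Monotonicity, dynamic programming and moduli of continuity\<close>

lemma hl_mono_space:
  assumes "x \<le> y"
  shows "hl t x \<le> hl t y"
proof (rule hl_least)
  fix d assume d: "0 < d" "d \<le> x"
  have "candidate t x d \<le> candidate t y d"
    unfolding candidate_def using d assms \<beta>_pos
    by (intro decay_mono) (auto intro: m0_le m0_nonneg)
  also have "\<dots> \<le> hl t y" using d assms by (intro hl_upper) auto
  finally show "candidate t x d \<le> hl t y" .
qed (rule hl_nonneg)

lemma hl_antimono_time:
  assumes "0 \<le> s" "s \<le> t"
  shows "hl t x \<le> hl s x"
proof (rule hl_least)
  fix d assume d: "0 < d" "d \<le> x"
  have "travel_cost \<alpha> s d \<le> travel_cost \<alpha> t d"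
    unfolding travel_cost_def using assms \<alpha> by (intro mult_right_mono powr_mono2) auto
  then have "candidate t x d \<le> candidate s x d"
    unfolding candidate_def using d \<beta>_pos by (intro decay_antimono) (auto intro: m0_nonneg)
  also have "\<dots> \<le> hl s x" using d by (rule hl_upper)
  finally show "candidate t x d \<le> hl s x" .
qed (rule hl_nonneg)

text \<open>The same displacement serves both points, so only the starting value changes, and
  \<open>decay\<close> is nonexpansive in it.\<close>

lemma hl_space_modulus:
  assumes "0 \<le> x" "x \<le> y" "e \<ge> 0" and mod: "\<And>z. z \<ge> 0 \<Longrightarrow> m\<^sub>0 (z + (y - x)) \<le> m\<^sub>0 z + e"
  shows "hl t y \<le> hl t x + e"
proof (rule hl_least)
  fix d assume d: "0 < d" "d \<le> y"
  show "candidate t y d \<le> hl t x + e"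
  proof (cases "d \<le> x")
    case True
    have "candidate t y d - candidate t x d \<le> m\<^sub>0 (y - d) - m\<^sub>0 (x - d)"
      unfolding candidate_def using True assms \<beta>_pos
      by (intro decay_diff_le) (auto intro: m0_nonneg m0_le)
    also have "\<dots> \<le> e" using mod[of "x - d"] True by simp
    finally show ?thesis using hl_upper[OF d(1) True, of t] by simp
  next
    \<comment> \<open>The displacement does not fit into \<open>[0, x]\<close>, but then
      \<open>y - d\<close> lies within \<open>y - x\<close> of 0, where \<open>m\<^sub>0\<close> is
      at most \<open>e\<close>.\<close>
    case False
    have "candidate t y d \<le> m\<^sub>0 (y - d)" using d by (intro candidate_le_m0)
    also have "\<dots> \<le> m\<^sub>0 (y - x)" using False d assms by (intro m0_le) auto
    also have "\<dots> \<le> e" using mod[of 0] by simp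
    finally show ?thesis using hl_nonneg[of t x] by simp
  qed
qed (use assms hl_nonneg[of t x] in simp)

text \<open>A nearly optimal displacement for time \<open>t\<close>, followed by \<open>e\<close> in
  time \<open>h\<close>, competes for time \<open>t + h\<close>. The semigroup law adds the costs,
  and subadditivity compares the sum with a single journey.\<close>

lemma hl_dynamic_programming:
  assumes "0 < e" "e \<le> x" "t \<ge> 0" "h \<ge> 0"
  shows "decay \<beta> (hl t (x - e)) (travel_cost \<alpha> h e) \<le> hl (t + h) x"
proof (rule field_le_epsilon)
  fix \<epsilon> :: real assume \<epsilon>: "\<epsilon> > 0"
  define a where "a = hl t (x - e)"
  show "decay \<beta> (hl t (x - e)) (travel_cost \<alpha> h e) \<le> hl (t + h) x + \<epsilon>"
  proof (cases "a \<le> \<epsilon>")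
    \<comment> \<open>This also covers \<open>x = e\<close>, where no displacement is available. In
      the other case \<open>a - \<epsilon>\<close> is positive, so \<open>hl_least\<close> applies
      to it.\<close>
    case True
    have "decay \<beta> a (travel_cost \<alpha> h e) \<le> a"
      using \<beta>_pos by (intro decay_le) (auto simp: a_def hl_nonneg)
    with True show ?thesis using hl_nonneg[of "t + h" x] by (simp add: a_def)
  next
    case False
    then have "\<not> a \<le> a - \<epsilon>" using \<epsilon> by simp
    with hl_least[of "x - e" t "a - \<epsilon>"] False
    obtain d where d: "0 < d" "d \<le> x - e" "candidate t (x - e) d > a - \<epsilon>"
      unfolding a_def by (force simp: not_le)
    let ?b = "candidate t (x - e) d"
    have b: "0 \<le> ?b" "?b \<le> a" using candidate_nonneg hl_upper d by (auto simp: a_def)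
    have "decay \<beta> a (travel_cost \<alpha> h e) - decay \<beta> ?b (travel_cost \<alpha> h e) \<le> a - ?b"
      using \<beta>_pos b by (intro decay_diff_le) auto
    moreover have "decay \<beta> ?b (travel_cost \<alpha> h e)
        = decay \<beta> (m\<^sub>0 (x - e - d)) (travel_cost \<alpha> t d + travel_cost \<alpha> h e)"
      unfolding candidate_def using \<beta>_pos d by (intro decay_decay) (auto intro: m0_nonneg)
    moreover have "\<dots> \<le> decay \<beta> (m\<^sub>0 (x - e - d)) (travel_cost \<alpha> (t + h) (d + e))"
      using \<beta>_pos d assms \<alpha> by (intro decay_antimono travel_cost_add) (auto intro: m0_nonneg)
    moreover have "\<dots> = candidate (t + h) x (d + e)"
      by (simp add: candidate_def algebra_simps)
    moreover have "\<dots> \<le> hl (t + h) x" using d assms by (intro hl_upper) auto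
    ultimately show ?thesis using d(3) by (simp add: a_def)
  qed
qed

text \<open>Stepping back by \<eta> loses at most \<open>e\<close>. Traversing \<eta> in the extra
  time \<open>h\<close> loses at most what the tangent of \<open>decay\<close> at cost 0 predicts,
  and \<open>M\<close> bounds its slope.\<close>

lemma hl_time_modulus:
  assumes "t \<ge> 0" "h \<ge> 0" "x \<ge> 0" "\<eta> > 0" "e \<ge> 0"
    and mod: "\<And>z. z \<ge> 0 \<Longrightarrow> m\<^sub>0 (z + \<eta>) \<le> m\<^sub>0 z + e"
  shows "hl t x \<le> hl (t + h) x + e + travel_cost \<alpha> h \<eta> * (M powr (1 + \<beta>) / \<beta>)"
proof (cases "\<eta> \<le> x")
  case True
  let ?a = "hl t (x - \<eta>)" and ?c = "travel_cost \<alpha> h \<eta>"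
  have "?a powr (1 + \<beta>) \<le> M powr (1 + \<beta>)"
    using \<beta>_pos True by (intro powr_mono2 hl_le_M) (auto simp: hl_nonneg)
  then have "?c * ?a powr (1 + \<beta>) / \<beta> \<le> ?c * M powr (1 + \<beta>) / \<beta>"
    using \<beta>_pos by (intro divide_right_mono mult_left_mono) auto
  moreover have "?a - ?c * ?a powr (1 + \<beta>) / \<beta> \<le> decay \<beta> ?a ?c"
    using decay_ge_tangent[of \<beta> ?a 0 ?c] \<beta>_pos by (simp add: hl_nonneg)
  moreover have "\<dots> \<le> hl (t + h) x" using assms True by (intro hl_dynamic_programming)
  moreover have "hl t x \<le> ?a + e" using assms True by (intro hl_space_modulus) auto
  ultimately show ?thesis by simp
next
  case False
  have "hl t x \<le> m\<^sub>0 x" using assms by (intro hl_le_m0)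
  also have "\<dots> \<le> m\<^sub>0 \<eta>" using False assms by (intro m0_le) auto
  also have "\<dots> \<le> e" using mod[of 0] by simp
  finally show ?thesis
    using hl_nonneg[of "t + h" x] \<beta>_pos by (simp add: add_increasing add_increasing2)
qed

lemma hl_dist_time:
  assumes "t \<ge> 0" "s \<ge> 0" "x \<ge> 0" "\<eta> > 0" "e \<ge> 0"
    and mod: "\<And>z. z \<ge> 0 \<Longrightarrow> m\<^sub>0 (z + \<eta>) \<le> m\<^sub>0 z + e"
  shows "\<bar>hl t x - hl s x\<bar> \<le> e + travel_cost \<alpha> \<bar>t - s\<bar> \<eta> * (M powr (1 + \<beta>) / \<beta>)"
proof -
  have time: "\<bar>hl t x - hl s x\<bar> \<le> e + travel_cost \<alpha> \<bar>t - s\<bar> \<eta> * (M powr (1 + \<beta>) / \<beta>)"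
    if "0 \<le> t" "t \<le> s" for t s
    using hl_time_modulus[OF that(1) _ assms(3,4,5) mod, of "s - t"] hl_antimono_time[OF that, of x] that
    by auto
  then show ?thesis
    using time[of t s] time[of s t] assms(1,2) by (cases "t \<le> s") (auto simp: abs_minus_commute)
qed

lemma hl_dist_space:
  assumes "x \<ge> 0" "y \<ge> 0" "e \<ge> 0"
    and mod: "\<And>z. z \<ge> 0 \<Longrightarrow> m\<^sub>0 (z + \<bar>x - y\<bar>) \<le> m\<^sub>0 z + e"
  shows "\<bar>hl t x - hl t y\<bar> \<le> e"
  using hl_space_modulus[of x y e t] hl_space_modulus[of y x e t] hl_mono_space[of x y t]
    hl_mono_space[of y x t] assms by (cases "x \<le> y") auto

definition m :: "real \<times> real \<Rightarrow> real" where
  "m X = hl (fst X) (snd X)"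

lemma m_uniformly_continuous: "uniformly_continuous_on quadrant m"
  unfolding uniformly_continuous_on_def
proof (intro allI impI)
  fix \<epsilon> :: real assume \<epsilon>: "\<epsilon> > 0"
  then obtain \<delta> where \<delta>: "\<delta> > 0"
    and m0: "\<And>y z. y \<ge> 0 \<Longrightarrow> z \<ge> 0 \<Longrightarrow> dist z y < \<delta> \<Longrightarrow> dist (m\<^sub>0 z) (m\<^sub>0 y) < \<epsilon> / 4"
    using m0_cont unfolding uniformly_continuous_on_def by (metis atLeast_iff zero_less_divide_iff zero_less_numeral)
  have mod: "m\<^sub>0 (z + k) \<le> m\<^sub>0 z + \<epsilon> / 4" if "z \<ge> 0" "0 \<le> k" "k < \<delta>" for z k
  proof -
    have "dist (m\<^sub>0 (z + k)) (m\<^sub>0 z) < \<epsilon> / 4"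
      using that by (intro m0) (auto simp: dist_real_def)
    then show ?thesis unfolding dist_real_def by linarith
  qed
  \<comment> \<open>The displacement stays fixed at \<open>\<delta> / 2\<close>, so the cost tends
    to 0 with the time difference.\<close>
  have "((\<lambda>h. travel_cost \<alpha> h (\<delta> / 2) * (M powr (1 + \<beta>) / \<beta>)) \<longlongrightarrow> 0) (at_right 0)"
    unfolding travel_cost_def using \<alpha> \<beta>_pos
    by (auto intro!: tendsto_eq_intros tendsto_mult_left_zero tendsto_zero_powrI eventually_at_right_less
        simp: eventually_at_filter)
  then have "\<forall>\<^sub>F h in at_right 0. travel_cost \<alpha> h (\<delta> / 2) * (M powr (1 + \<beta>) / \<beta>) < \<epsilon> / 4"
    using \<epsilon> by (intro order_tendstoD(2)) auto
  then obtain \<tau> where \<tau>: "\<tau> > 0"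
      "\<And>h. 0 < h \<Longrightarrow> h < \<tau> \<Longrightarrow> travel_cost \<alpha> h (\<delta> / 2) * (M powr (1 + \<beta>) / \<beta>) < \<epsilon> / 4"
    unfolding eventually_at_right_field by auto
  show "\<exists>d>0. \<forall>X\<in>quadrant. \<forall>Y\<in>quadrant. dist Y X < d \<longrightarrow> dist (m Y) (m X) < \<epsilon>"
  proof (intro exI[of _ "min \<delta> \<tau>"] conjI ballI impI)
    fix X Y assume q: "X \<in> quadrant" "Y \<in> quadrant" and d: "dist Y X < min \<delta> \<tau>"
    have "\<bar>fst Y - fst X\<bar> < \<tau>" "\<bar>snd Y - snd X\<bar> < \<delta>"
      using d dist_fst_le[of Y X] dist_snd_le[of Y X] by (auto simp: dist_real_def)
    moreover have "\<bar>hl (fst Y) (snd X) - hl (fst X) (snd X)\<bar> \<le> \<epsilon> / 4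
        + travel_cost \<alpha> \<bar>fst Y - fst X\<bar> (\<delta> / 2) * (M powr (1 + \<beta>) / \<beta>)"
      using q \<delta> \<epsilon> by (intro hl_dist_time mod) (auto simp: quadrant_def)
    moreover have "\<bar>hl (fst Y) (snd Y) - hl (fst Y) (snd X)\<bar> \<le> \<epsilon> / 4"
      using q \<epsilon> calculation by (intro hl_dist_space mod) (auto simp: quadrant_def)
    moreover have "travel_cost \<alpha> \<bar>fst Y - fst X\<bar> (\<delta> / 2) * (M powr (1 + \<beta>) / \<beta>) < \<epsilon> / 4"
      using \<tau>(2)[of "\<bar>fst Y - fst X\<bar>"] calculation(1) \<epsilon> by (cases "fst Y = fst X") auto
    ultimately show "dist (m Y) (m X) < \<epsilon>"
      unfolding m_def dist_real_def by linarith
  qed (use \<delta> \<tau>(1) in simp)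
qed

text \<open>With the displacement equal to the time difference, homogeneity makes the cost linear in
  that difference.\<close>

lemma m_lipschitz:
  assumes L: "L-lipschitz_on {0..} m\<^sub>0"
  shows "\<exists>L. L-lipschitz_on quadrant m"
proof -
  define K where "K = travel_cost \<alpha> 1 1 * (M powr (1 + \<beta>) / \<beta>)"
  have nn: "L \<ge> 0" "K \<ge> 0"
    using lipschitz_on_nonneg[OF L] \<beta>_pos by (auto simp: K_def)
  have mod: "m\<^sub>0 (z + k) \<le> m\<^sub>0 z + L * k" if "z \<ge> 0" "k \<ge> 0" for z k
    using lipschitz_onD[OF L, of "z + k" z] that by (auto simp: dist_real_def)
  have "(2 * L + K)-lipschitz_on quadrant m"
  proof (rule lipschitz_onI)
    fix X Y assume q: "X \<in> quadrant" "Y \<in> quadrant"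
    define h k where "h = \<bar>fst X - fst Y\<bar>" and "k = \<bar>snd X - snd Y\<bar>"
    have hk: "h \<le> dist X Y" "k \<le> dist X Y" "h \<ge> 0" "k \<ge> 0"
      using dist_fst_le[of X Y] dist_snd_le[of X Y] by (auto simp: dist_real_def h_def k_def)
    have "\<bar>hl (fst X) (snd X) - hl (fst Y) (snd X)\<bar> \<le> L * h + K * h"
    proof (cases "h = 0")
      case False
      then have h: "h > 0" using hk by simp
      have "travel_cost \<alpha> h h = h * travel_cost \<alpha> 1 1"
        using travel_cost_scale[OF \<alpha>, of h 1 1] h by simp
      moreover have "\<bar>hl (fst X) (snd X) - hl (fst Y) (snd X)\<bar> \<le> L * h
          + travel_cost \<alpha> \<bar>fst X - fst Y\<bar> h * (M powr (1 + \<beta>) / \<beta>)"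
        using q nn h mod by (intro hl_dist_time) (auto simp: quadrant_def)
      ultimately show ?thesis by (simp add: h_def[symmetric] K_def mult_ac)
    qed (simp add: h_def)
    moreover have "\<bar>hl (fst Y) (snd X) - hl (fst Y) (snd Y)\<bar> \<le> L * k"
      using q nn hk mod by (intro hl_dist_space) (auto simp: quadrant_def k_def)
    ultimately have "\<bar>m X - m Y\<bar> \<le> L * h + L * k + K * h"
      unfolding m_def by linarith
    also have "\<dots> \<le> L * dist X Y + L * dist X Y + K * dist X Y"
      using hk nn by (intro add_mono mult_left_mono)
    finally show "dist (m X) (m Y) \<le> (2 * L + K) * dist X Y"
      by (simp add: dist_real_def algebra_simps)
  qed (use nn in simp)
  then show ?thesis ..
qed


section \<open>Viscosity inequalities for the Hopf-Lax function\<close>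

text \<open>Candidates are at most linear in \<open>d\<close>, so a positive supremum is decided on
  a compact interval away from 0, where the candidate is continuous.\<close>

lemma hl_attained:
  assumes "t > 0" "x > 0" "hl t x > 0"
  obtains d where "0 < d" "d \<le> x" "candidate t x d = hl t x"
proof -
  define \<kappa> where "\<kappa> = ((\<alpha> * t) powr (1 / (1 - \<alpha>))) powr (- 1 / \<beta>)"
  have \<kappa>: "\<kappa> > 0" using assms \<alpha> by (simp add: \<kappa>_def)
  have small: "candidate t x d \<le> \<kappa> * d" if d: "0 < d" "d \<le> x" for d
  proof -
    have "travel_cost \<alpha> t d > 0" using assms \<alpha> d by (simp add: travel_cost_def)
    then have "candidate t x d \<le> travel_cost \<alpha> t d powr (- 1 / \<beta>)"
      unfolding candidate_def using \<beta>_pos d by (intro decay_le_bound) (auto intro: m0_nonneg)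
    also have "\<dots> = \<kappa> * (d powr (- \<beta>)) powr (- 1 / \<beta>)"
      unfolding travel_cost_def \<beta>_def[symmetric] \<kappa>_def by (rule powr_mult)
    also have "(d powr (- \<beta>)) powr (- 1 / \<beta>) = d" using d \<beta>_pos by (simp add: powr_powr)
    finally show ?thesis .
  qed
  \<comment> \<open>Candidates with displacement below this threshold are at most
    \<open>hl t x / 2\<close>.\<close>
  define \<delta> where "\<delta> = min x (hl t x / (2 * \<kappa>))"
  have \<delta>: "\<delta> > 0" "\<delta> \<le> x" using assms \<kappa> by (auto simp: \<delta>_def)
  have "continuous_on {0..} m\<^sub>0" using m0_cont by (rule uniformly_continuous_imp_continuous)
  then have c1: "continuous_on {\<delta>..x} (\<lambda>d. m\<^sub>0 (x - d))"
    by (rule continuous_on_compose2) (auto intro!: continuous_intros)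
  have c2: "continuous_on {\<delta>..x} (\<lambda>d. m\<^sub>0 (x - d) powr \<beta>)"
    using \<beta>_pos by (intro continuous_on_powr' c1 continuous_on_const) (simp add: m0_nonneg)
  have c3: "continuous_on {\<delta>..x} (travel_cost \<alpha> t)"
    unfolding travel_cost_def using \<delta>
    by (intro continuous_on_mult continuous_on_powr continuous_on_const continuous_on_id) auto
  have "1 + travel_cost \<alpha> t d * m\<^sub>0 (x - d) powr \<beta> \<noteq> 0" for d
    using mult_nonneg_nonneg[OF travel_cost_nonneg[of \<alpha> t d] powr_ge_zero[of "m\<^sub>0 (x - d)" \<beta>]] by linarith
  then have "continuous_on {\<delta>..x} (candidate t x)"
    unfolding candidate_def decay_def
    by (intro continuous_on_mult continuous_on_powr continuous_on_add continuous_on_const c1 c2 c3) simp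
  with \<delta>(2) obtain d where d: "d \<in> {\<delta>..x}" "\<forall>y\<in>{\<delta>..x}. candidate t x y \<le> candidate t x d"
    using continuous_attains_sup[of "{\<delta>..x}" "candidate t x"] by (metis atLeastatMost_empty_iff2 compact_Icc not_le)
  have "hl t x \<le> max (candidate t x d) (hl t x / 2)"
  proof (rule hl_least)
    fix y assume y: "0 < y" "y \<le> x"
    show "candidate t x y \<le> max (candidate t x d) (hl t x / 2)"
    proof (cases "\<delta> \<le> y")
      case False
      then have "y \<le> hl t x / (2 * \<kappa>)" using y by (auto simp: \<delta>_def)
      then have "\<kappa> * y \<le> hl t x / 2" using \<kappa> by (simp add: field_simps)
      with small[OF y] show ?thesis by simp
    next
      case True
      then have "candidate t x y \<le> candidate t x d" using d(2) y by simp
      then show ?thesis by simp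
    qed
  qed (use assms in simp)
  then have "hl t x \<le> candidate t x d" using assms by auto
  moreover have "candidate t x d \<le> hl t x" using d \<delta> by (intro hl_upper) auto
  ultimately show thesis using d \<delta> by (intro that[of d]) auto
qed

text \<open>A finite cost never turns a positive value into 0. Hence \<open>hl t x = 0\<close> means
  that \<open>m\<^sub>0\<close> vanishes on \<open>[0, x)\<close>, a condition free of time.\<close>

lemma hl_zero_persists:
  assumes "x \<ge> 0" "hl t x = 0"
  shows "hl s x = 0"
proof -
  have "hl s x \<le> 0"
  proof (rule hl_least)
    fix d assume d: "0 < d" "d \<le> x"
    then have "candidate t x d \<le> 0" using hl_upper[OF d, of t] assms by simp
    then have "\<not> m\<^sub>0 (x - d) > 0"
      using decay_pos[of "m\<^sub>0 (x - d)" "travel_cost \<alpha> t d" \<beta>] by (auto simp: candidate_def)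
    then show "candidate s x d \<le> 0"
      using candidate_le_m0[of d x s] d by simp
  qed simp
  with hl_nonneg[of s x] show ?thesis by simp
qed

lemma eventually_small:
  assumes "c > (0::real)"
  shows "\<forall>\<^sub>F h in at_right 0. 0 < h \<and> h < c"
  using assms by (auto simp: eventually_at_right_field)

lemma travel_cost_ray:
  assumes "h \<ge> 0" "v > 0"
  shows "travel_cost \<alpha> h (h * v) = h * travel_cost \<alpha> 1 v"
  using travel_cost_scale[OF \<alpha>, of h 1 v] assms by simp

lemma m_subsolution: "viscosity_subsolution \<alpha> m\<^sub>0 m"
  unfolding viscosity_subsolution_def
proof (intro conjI allI impI)
  show "continuous_on quadrant m"
    by (rule uniformly_continuous_imp_continuous[OF m_uniformly_continuous])
next
  fix t x :: real assume pos: "t > 0" "x > 0"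
  have "p\<^sub>1 + max p\<^sub>2 0 powr \<alpha> * m (t, x) \<le> 0"
    if p: "(p\<^sub>1, p\<^sub>2) \<in> superdifferential m (t, x)" for p\<^sub>1 p\<^sub>2
  proof -
    \<comment> \<open>Monotonicity in time gives \<open>p\<^sub>1 \<le> 0\<close>, which settles the
      cases where the Hamiltonian vanishes.\<close>
    have "\<forall>\<^sub>F h in at_right 0. h * 0 \<le> m (t + h * - 1, x + h * 0) - m (t, x)"
      using eventually_small[OF pos(1)] by eventually_elim (simp add: m_def hl_antimono_time)
    from superdifferential_ray[OF pos p this tendsto_const] have p1: "p\<^sub>1 \<le> 0" by simp
    show ?thesis
    proof (cases "p\<^sub>2 > 0 \<and> hl t x > 0")
      case True
      then obtain d where d: "0 < d" "d \<le> x" "candidate t x d = hl t x"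
        using hl_attained[OF pos] by metis
      \<comment> \<open>The speed of the maximising segment. Moving back along it keeps the starting
        point \<open>x - d\<close> and lowers the cost at rate
        \<open>travel_cost \<alpha> 1 v\<close>; the tangent of \<open>decay\<close> turns this into
        growth at rate at least \<open>c\<close>.\<close>
      define v where "v = d / t"
      have v: "v > 0" "t * v = d" using d pos by (auto simp: v_def)
      define c where "c = travel_cost \<alpha> 1 v * hl t x powr (1 + \<beta>) / \<beta>"
      have "\<forall>\<^sub>F h in at_right 0. h * c \<le> m (t + h * - 1, x + h * - v) - m (t, x)"
        using eventually_small[OF pos(1)]
      proof eventually_elim
        case (elim h)
        let ?s = "t * travel_cost \<alpha> 1 v" and ?s' = "(t - h) * travel_cost \<alpha> 1 v"
        have cand: "candidate t x d = decay \<beta> (m\<^sub>0 (x - d)) ?s"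
          using travel_cost_ray[of t v] v pos by (simp add: candidate_def)
        have "hl t x + h * c = decay \<beta> (m\<^sub>0 (x - d)) ?s
            + (?s - ?s') * decay \<beta> (m\<^sub>0 (x - d)) ?s powr (1 + \<beta>) / \<beta>"
          unfolding cand[symmetric] d(3) c_def by (simp add: algebra_simps)
        also have "\<dots> \<le> decay \<beta> (m\<^sub>0 (x - d)) ?s'"
          using \<beta>_pos d pos elim by (intro decay_ge_tangent) (auto intro: m0_nonneg)
        also have "\<dots> = candidate (t - h) (x - h * v) ((t - h) * v)"
        proof -
          have "x - h * v - (t - h) * v = x - d" using v(2) by (simp add: algebra_simps)
          then show ?thesis using travel_cost_ray[of "t - h" v] v elim by (simp only: candidate_def) simp
        qed
        also have "\<dots> \<le> hl (t - h) (x - h * v)"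
          using elim v d by (intro hl_upper) (auto simp: algebra_simps)
        finally show ?case by (simp add: m_def)
      qed
      from superdifferential_ray[OF pos p this tendsto_const]
      have "c \<le> - p\<^sub>1 - p\<^sub>2 * v" by simp
      moreover have "p\<^sub>2 powr \<alpha> * hl t x \<le> p\<^sub>2 * v + c"
        unfolding c_def \<beta>_def using \<alpha> True v by (intro travel_cost_young) auto
      ultimately show ?thesis using True by (simp add: m_def max_def)
    next
      case False
      then have "max p\<^sub>2 0 powr \<alpha> * m (t, x) = 0"
        using hl_nonneg[of t x] \<alpha> by (auto simp: m_def max_def)
      then show ?thesis using p1 by (simp only: add_0_right)
    qed
  qed
  then show "\<forall>(p\<^sub>1, p\<^sub>2)\<in>superdifferential m (t, x). p\<^sub>1 + max p\<^sub>2 0 powr \<alpha> * m (t, x) \<le> 0"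
    by blast
qed (simp_all add: m_def hl_initial)

text \<open>Dynamic programming gives one linear inequality in the gradient for every speed
  \<open>v\<close>. Minimising over \<open>v\<close> recovers the Hamiltonian through the equality
  case of Young's inequality.\<close>

lemma m_supersolution: "viscosity_supersolution \<alpha> m\<^sub>0 m"
  unfolding viscosity_supersolution_def
proof (intro conjI allI impI)
  show cont: "continuous_on quadrant m"
    by (rule uniformly_continuous_imp_continuous[OF m_uniformly_continuous])
  fix t x :: real assume pos: "t > 0" "x > 0"
  have "p\<^sub>1 + max p\<^sub>2 0 powr \<alpha> * m (t, x) \<ge> 0"
    if p: "(p\<^sub>1, p\<^sub>2) \<in> subdifferential m (t, x)" for p\<^sub>1 p\<^sub>2
  proof (cases "hl t x = 0")
    case True
    \<comment> \<open>Where the solution vanishes it is constant in time, so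
      \<open>p\<^sub>1 \<ge> 0\<close>.\<close>
    have "\<forall>\<^sub>F h in at_right 0. m (t + h * - 1, x + h * 0) - m (t, x) \<le> h * 0"
      using hl_zero_persists[OF _ True] pos True by (simp add: m_def)
    from subdifferential_ray[OF pos p this tendsto_const] True show ?thesis by (simp add: m_def)
  next
    case False
    then have \<mu>: "hl t x > 0" using hl_nonneg[of t x] by simp
    have "\<forall>\<^sub>F h in at_right 0. m (t + h * 0, x + h * - 1) - m (t, x) \<le> h * 0"
      using eventually_small[OF pos(2)] by eventually_elim (simp add: m_def hl_mono_space)
    from subdifferential_ray[OF pos p this tendsto_const] have p2: "p\<^sub>2 \<ge> 0" by simp
    have ray: "p\<^sub>1 + p\<^sub>2 * v + travel_cost \<alpha> 1 v * hl t x powr (1 + \<beta>) / \<beta> \<ge> 0" if v: "v > 0" for v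
    proof -
      \<comment> \<open>The tangent of \<open>decay\<close> is taken with the value at the moved
        point; continuity of \<open>m\<close> brings it back to \<open>hl t x\<close> as
        \<open>h\<close> tends to 0.\<close>
      define a where "a h = m (t + h * - 1, x + h * - v)" for h
      have "\<forall>\<^sub>F h in at_right 0. m (t + h * - 1, x + h * - v) - m (t, x)
          \<le> h * (travel_cost \<alpha> 1 v * a h powr (1 + \<beta>) / \<beta>)"
        using eventually_small[OF pos(1)] eventually_small[OF divide_pos_pos[OF pos(2) v]]
      proof eventually_elim
        case (elim h)
        then have hv: "0 < h * v" "h * v \<le> x" using v by (auto simp: pos_less_divide_eq)
        have "a h - travel_cost \<alpha> h (h * v) * a h powr (1 + \<beta>) / \<beta>
            \<le> decay \<beta> (a h) (travel_cost \<alpha> h (h * v))"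
          using decay_ge_tangent[of \<beta> "a h" 0 "travel_cost \<alpha> h (h * v)"] \<beta>_pos
          by (simp add: a_def m_def hl_nonneg)
        also have "\<dots> \<le> hl t x"
          using hl_dynamic_programming[OF hv, of "t - h" h] elim by (simp add: a_def m_def)
        finally show ?case
          unfolding a_def[symmetric] using travel_cost_ray[of h v] elim v
          by (simp add: m_def mult.assoc)
      qed
      moreover have "((\<lambda>h. travel_cost \<alpha> 1 v * a h powr (1 + \<beta>) / \<beta>)
          \<longlongrightarrow> travel_cost \<alpha> 1 v * hl t x powr (1 + \<beta>) / \<beta>) (at_right 0)"
      proof -
        have "(t, x) \<in> quadrant" using pos by (simp add: quadrant_def)
        then have "(m \<longlongrightarrow> m (t, x)) (at (t, x))"
          using cont at_within_quadrant[OF pos] unfolding continuous_on_def by fastforce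
        then have "(m \<longlongrightarrow> m (t, x)) (nhds (t, x))"
          by (simp add: tendsto_nhds_iff)
        moreover have "filterlim (\<lambda>h. (t + h * - 1, x + h * - v)) (nhds (t, x)) (at_right 0)"
          by (intro tendsto_eq_intros) auto
        ultimately have "(a \<longlongrightarrow> hl t x) (at_right 0)"
          unfolding a_def by (auto simp: m_def dest: filterlim_compose)
        then show ?thesis using \<beta>_pos \<mu> by (intro tendsto_intros) auto
      qed
      ultimately have "p\<^sub>1 * - 1 + p\<^sub>2 * - v \<le> travel_cost \<alpha> 1 v * hl t x powr (1 + \<beta>) / \<beta>"
        by (rule subdifferential_ray[OF pos p])
      then show ?thesis by simp
    qed
    show ?thesis
    proof (cases "p\<^sub>2 = 0")
      case True
      \<comment> \<open>For \<open>p\<^sub>2 = 0\<close> no finite speed is optimal: the infimum is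
        approached as \<open>v\<close> tends to infinity, where the cost vanishes.\<close>
      have "((\<lambda>v. v powr (- \<beta>)) \<longlongrightarrow> 0) at_top"
        using \<beta>_pos by (intro tendsto_neg_powr filterlim_ident) auto
      then have "((\<lambda>v. \<alpha> powr (1 / (1 - \<alpha>)) * v powr (- \<beta>) * hl t x powr (1 + \<beta>) / \<beta>)
          \<longlongrightarrow> \<alpha> powr (1 / (1 - \<alpha>)) * 0 * hl t x powr (1 + \<beta>) / \<beta>) at_top"
        using \<beta>_pos by (intro tendsto_divide tendsto_mult tendsto_const) auto
      from tendsto_add[OF tendsto_const[of p\<^sub>1] this]
      have "((\<lambda>v. p\<^sub>1 + p\<^sub>2 * v + travel_cost \<alpha> 1 v * hl t x powr (1 + \<beta>) / \<beta>) \<longlongrightarrow> p\<^sub>1) at_top"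
        by (simp add: travel_cost_def \<beta>_def[symmetric] True)
      moreover have "\<forall>\<^sub>F v in at_top. 0 \<le> p\<^sub>1 + p\<^sub>2 * v + travel_cost \<alpha> 1 v * hl t x powr (1 + \<beta>) / \<beta>"
        using eventually_gt_at_top[of 0] ray by (rule eventually_mono)
      ultimately have "p\<^sub>1 \<ge> 0"
        by (rule tendsto_lowerbound) (rule trivial_limit_at_top_linorder)
      with True show ?thesis by simp
    next
      case False
      with p2 have "p\<^sub>2 > 0" by simp
      then obtain v where "v > 0"
          "p\<^sub>2 powr \<alpha> * hl t x = p\<^sub>2 * v + travel_cost \<alpha> 1 v * hl t x powr (1 + \<beta>) / \<beta>"
        unfolding \<beta>_def by (rule travel_cost_young_eq[OF \<alpha> _ \<mu>])
      with ray[of v] \<open>p\<^sub>2 > 0\<close> show ?thesis by (simp add: m_def max_def)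
    qed
  qed
  then show "\<forall>(p\<^sub>1, p\<^sub>2)\<in>subdifferential m (t, x). p\<^sub>1 + max p\<^sub>2 0 powr \<alpha> * m (t, x) \<ge> 0"
    by blast
qed (simp_all add: m_def hl_initial)

section \<open>Existence, uniqueness and Lipschitz regularity\<close>

lemma m_buc_viscosity_solution: "buc_viscosity_solution \<alpha> m\<^sub>0 m"
  unfolding buc_viscosity_solution_def viscosity_solution_def
proof (intro conjI m_subsolution m_supersolution m_uniformly_continuous)
  show "bounded (m ` quadrant)"
    using hl_nonneg hl_le_M by (auto simp: bounded_iff m_def quadrant_def intro!: exI[of _ M])
qed

lemma m_unique:
  assumes "buc_viscosity_solution \<alpha> m\<^sub>0 m'" "X \<in> quadrant"
  shows "m' X = m X"
proof (rule order_antisym)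
  note m' = assms(1)[unfolded buc_viscosity_solution_def viscosity_solution_def]
    and m = m_buc_viscosity_solution[unfolded buc_viscosity_solution_def viscosity_solution_def]
  show "m' X \<le> m X" "m X \<le> m' X"
    by (rule comparison[of \<alpha> m\<^sub>0]; use m m' assms(2) \<alpha> m0_nonneg in simp)+
qed

end

theorem theorem7p14:
  fixes \<alpha> :: real and m\<^sub>0 :: "real \<Rightarrow> real"
  assumes "0 < \<alpha>" and "\<alpha> < 1"
    and "bounded (m\<^sub>0 ` {0..})"
    and "uniformly_continuous_on {0..} m\<^sub>0"
    and "mono_on {0..} m\<^sub>0"
    and "m\<^sub>0 0 = 0"
  shows "\<exists>m. buc_viscosity_solution \<alpha> m\<^sub>0 m \<and>
             (\<forall>m'. buc_viscosity_solution \<alpha> m\<^sub>0 m' \<longrightarrow> (\<forall>X\<in>quadrant. m' X = m X)) \<and>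
             ((\<exists>L. L-lipschitz_on {0..} m\<^sub>0) \<longrightarrow> (\<exists>L. L-lipschitz_on quadrant m))"
proof -
  obtain M where "\<And>x. x \<ge> 0 \<Longrightarrow> \<bar>m\<^sub>0 x\<bar> \<le> M"
    using assms(3) by (auto simp: bounded_iff)
  then interpret hopf_lax \<alpha> m\<^sub>0 M
    using assms by unfold_locales (auto intro: order_trans[OF abs_ge_self])
  show ?thesis
    using m_buc_viscosity_solution m_unique m_lipschitz by blast
qed

end
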